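(* The $\nu$-focused system is sound and complete with respect to $\mu$MALL: if $\vdash\ \Uparrow\Gamma$ is provable in the $\nu$-focused system, then $\vdash\Gamma$ is provable in $\mu$MALL; and if $\vdash\Gamma$ has a quasi-finite $\mu$MALL derivation, then $\vdash\ \Uparrow\Gamma$ has a focused derivation.
   Context: $\mu$MALL is first-order MALL (connectives $\otimes$, ⅋ (par), $\oplus$, $\&$, units, $\forall,\exists$, $=$, $\neq$) with least/greatest fixed points of monotonic operators, an unfolding rule for $\mu$ and a (co)induction rule for $\nu$ with coinvariant $S$. A derivation is quasi-finite if it is cut-free, has finite height, and uses finitely many distinct coinvariants. The $\nu$-focused system is Andreoli-style focusing (sequents $\vdash\Gamma\Uparrow\Delta$ and $\vdash\Gamma\Downarrow P$, with ⅋, $\bot$, $\&$, $\top$, $\forall$, $\neq$ and negated atoms asynchronous; $\otimes$, $\mathbf{1}$, $\oplus$, $\mathbf{0}$, $\exists$, $=$ and atoms synchronous; frozen formulas $P^*$ and switching rules), in which, contrary to the $\mu$-focused system, $\mu$ is treated asynchronously and $\nu$ synchronously: in the asynchronous phase $\mu B\vec t$ is either unfolded ($\vdash\Gamma\Uparrow B(\mu B)\vec t,\Delta$) or frozen ($\vdash\Gamma,(\mu B\vec t)^*\Uparrow\Delta$); in the synchronous phase $\nu B\vec t$ is either coinducted on (premises $\vdash\Gamma\Downarrow S\vec t$ and $\vdash\ \Uparrow BS\vec x,(S\vec x)^\perp$) or closed by the axiom $\vdash(\mu\overline{B}\vec t)^*\Downarrow\nu B\vec t$. *)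

theory Defs
  imports "HOL-Library.Multiset" "HOL-Library.Extended_Nat"
begin

section \<open>Term languages\<close>

text \<open>
  A many-sorted term language with its substitution operation. Variables are de Bruijn indices
  kept separately for every sort: \<open>var s j\<close> is the \<open>j\<close>-th variable of sort \<open>s\<close>, and a binder of
  sort \<open>s\<close> captures \<open>var s 0\<close> and renumbers the variables of sort \<open>s\<close> only. \<open>Tm s\<close> is the set of
  terms of sort \<open>s\<close>, and \<open>tsub \<sigma> t\<close> is simultaneous substitution. First-order terms and simply typed
  lambda-terms modulo beta-eta, over any signature, are instances (proved at the end of this theory).
\<close>

type_synonym ('s, 't) sbst = "'s \<Rightarrow> nat \<Rightarrow> 't"

locale term_language =
  fixes Tm :: "'s \<Rightarrow> 't set"
    and var :: "'s \<Rightarrow> nat \<Rightarrow> 't"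
    and tsub :: "('s, 't) sbst \<Rightarrow> 't \<Rightarrow> 't"
  assumes var_Tm: "var s j \<in> Tm s"
    and tsub_Tm: "(\<And>s j. \<sigma> s j \<in> Tm s) \<Longrightarrow> t \<in> Tm s \<Longrightarrow> tsub \<sigma> t \<in> Tm s"
    and tsub_var: "(\<And>s j. \<sigma> s j \<in> Tm s) \<Longrightarrow> tsub \<sigma> (var s j) = \<sigma> s j"
    and tsub_id: "t \<in> Tm s \<Longrightarrow> tsub var t = t"
    and tsub_tsub: "(\<And>s j. \<sigma> s j \<in> Tm s) \<Longrightarrow> (\<And>s j. \<tau> s j \<in> Tm s) \<Longrightarrow> t \<in> Tm s \<Longrightarrow>
          tsub \<tau> (tsub \<sigma> t) = tsub (\<lambda>s j. tsub \<tau> (\<sigma> s j)) t"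
begin

definition is_sbst :: "('s, 't) sbst \<Rightarrow> bool" where
  "is_sbst \<sigma> \<longleftrightarrow> (\<forall>s j. \<sigma> s j \<in> Tm s)"

definition unifier :: "'t \<Rightarrow> 't \<Rightarrow> ('s, 't) sbst \<Rightarrow> bool" where
  "unifier t u \<theta> \<longleftrightarrow> is_sbst \<theta> \<and> tsub \<theta> t = tsub \<theta> u"

text \<open>Complete sets of unifiers; they may be infinite.\<close>

definition csu :: "'t \<Rightarrow> 't \<Rightarrow> ('s, 't) sbst set \<Rightarrow> bool" where
  "csu t u U \<longleftrightarrow>
     (\<forall>\<theta>\<in>U. unifier t u \<theta>) \<and>
     (\<forall>\<sigma>. unifier t u \<sigma> \<longrightarrow> (\<exists>\<theta>\<in>U. \<exists>\<delta>. is_sbst \<delta> \<and> \<sigma> = (\<lambda>s j. tsub \<delta> (\<theta> s j))))"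

text \<open>
  A vector of binders of sorts \<open>s\<^sub>1, \<dots>, s\<^sub>n\<close> binds, for each sort, its occurrences in the list in
  order: the first occurrence of \<open>s\<close> is \<open>var s 0\<close>, the second one \<open>var s 1\<close>, and so on.
  \<open>shift ss\<close> moves a term below such binders, \<open>bvars ss\<close> lists the bound variables,
  \<open>ups ss \<sigma>\<close> is \<open>\<sigma>\<close> acting below the binders, and \<open>inst ss ts\<close> removes the binders,
  replacing the bound variables by \<open>ts\<close>.
\<close>

definition shift :: "'s list \<Rightarrow> ('s, 't) sbst" where
  "shift ss = (\<lambda>s j. var s (j + count_list ss s))"

definition scons :: "'s \<Rightarrow> 't \<Rightarrow> ('s, 't) sbst \<Rightarrow> ('s, 't) sbst" where
  "scons s t \<sigma> = (\<lambda>s' j. if s' = s then (case j of 0 \<Rightarrow> t | Suc i \<Rightarrow> \<sigma> s i) else \<sigma> s' j)"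

primrec bvars :: "'s list \<Rightarrow> 't list" where
  "bvars [] = []"
| "bvars (s # ss) = var s 0 # map (tsub (shift [s])) (bvars ss)"

primrec ups :: "'s list \<Rightarrow> ('s, 't) sbst \<Rightarrow> ('s, 't) sbst" where
  "ups [] \<sigma> = \<sigma>"
| "ups (s # ss) \<sigma> = scons s (var s 0) (\<lambda>s' j. tsub (shift [s]) (ups ss \<sigma> s' j))"

primrec inst :: "'s list \<Rightarrow> 't list \<Rightarrow> ('s, 't) sbst" where
  "inst [] ts = var"
| "inst (s # ss) ts = scons s (hd ts) (inst ss (tl ts))"

end

section \<open>Formulas\<close>

text \<open>
  In \<open>Mu ss B ts\<close> and \<open>Nu ss B ts\<close> the body \<open>B\<close> stands for the operator \<open>\<lambda>p. \<lambda>x\<^sub>1 \<dots> x\<^sub>n. B\<close> where the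
  \<open>x\<^sub>i\<close> have the sorts \<open>ss\<close>; \<open>p\<close> is the predicate variable with de Bruijn index \<open>0\<close>. There
  are no negated predicate variables, so every operator is monotonic.
\<close>

datatype ('s, 't, 'a) form =
    Tensor "('s, 't, 'a) form" "('s, 't, 'a) form"
  | Par "('s, 't, 'a) form" "('s, 't, 'a) form"
  | Plus "('s, 't, 'a) form" "('s, 't, 'a) form"
  | With "('s, 't, 'a) form" "('s, 't, 'a) form"
  | One | Bot | Zero | Top
  | Ex 's "('s, 't, 'a) form"
  | All 's "('s, 't, 'a) form"
  | Eq 's 't 't
  | Neq 's 't 't
  | Atom 'a "'t list"
  | NAtom 'a "'t list"
  | PVar nat "'t list"
  | Mu "'s list" "('s, 't, 'a) form" "'t list"
  | Nu "'s list" "('s, 't, 'a) form" "'t list"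

text \<open>
  On predicate variables \<open>neg\<close> is the identity: applied to the body of an operator \<open>B\<close> it
  thus yields the body of the dual operator \<open>\<lambda>p. \<lambda>x. (B p\<^sup>\<bottom> x)\<^sup>\<bottom>\<close>.
\<close>

primrec neg :: "('s, 't, 'a) form \<Rightarrow> ('s, 't, 'a) form" where
  "neg (Tensor P Q) = Par (neg P) (neg Q)"
| "neg (Par P Q) = Tensor (neg P) (neg Q)"
| "neg (Plus P Q) = With (neg P) (neg Q)"
| "neg (With P Q) = Plus (neg P) (neg Q)"
| "neg One = Bot"
| "neg Bot = One"
| "neg Zero = Top"
| "neg Top = Zero"
| "neg (Ex s P) = All s (neg P)"
| "neg (All s P) = Ex s (neg P)"
| "neg (Eq s t u) = Neq s t u"
| "neg (Neq s t u) = Eq s t u"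
| "neg (Atom a ts) = NAtom a ts"
| "neg (NAtom a ts) = Atom a ts"
| "neg (PVar i ts) = PVar i ts"
| "neg (Mu ss B ts) = Nu ss (neg B) ts"
| "neg (Nu ss B ts) = Mu ss (neg B) ts"

primrec async :: "('s, 't, 'a) form \<Rightarrow> bool" where
  "async (Tensor P Q) = False"
| "async (Par P Q) = True"
| "async (Plus P Q) = False"
| "async (With P Q) = True"
| "async One = False"
| "async Bot = True"
| "async Zero = False"
| "async Top = True"
| "async (Ex s P) = False"
| "async (All s P) = True"
| "async (Eq s t u) = False"
| "async (Neq s t u) = True"
| "async (Atom a ts) = False"
| "async (NAtom a ts) = True"
| "async (PVar i ts) = False"
| "async (Mu ss B ts) = True"
| "async (Nu ss B ts) = False"

text \<open>
  The inference tree of a derivation. An inference with one premise per unifier stores its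
  (possibly infinite) set of unifiers; a coinduction stores the coinvariant \<open>\<lambda>x\<^sub>1 \<dots> x\<^sub>n. S\<close>
  as the pair of the sorts of the \<open>x\<^sub>i\<close> and the formula \<open>S\<close>.
\<close>

datatype ('s, 't, 'a) deriv =
    Inf0
  | Inf1 "('s, 't, 'a) deriv"
  | Inf2 "('s, 't, 'a) deriv" "('s, 't, 'a) deriv"
  | InfNeq "('s, 't) sbst set" "('s, 't) sbst \<Rightarrow> ('s, 't, 'a) deriv"
  | InfNu "'s list \<times> ('s, 't, 'a) form" "('s, 't, 'a) deriv" "('s, 't, 'a) deriv"
  | InfCut "('s, 't, 'a) deriv" "('s, 't, 'a) deriv"

primrec cut_free :: "('s, 't, 'a) deriv \<Rightarrow> bool" where
  "cut_free Inf0 = True"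
| "cut_free (Inf1 d) = cut_free d"
| "cut_free (Inf2 d e) = (cut_free d \<and> cut_free e)"
| "cut_free (InfNeq U f) = (\<forall>\<theta>\<in>U. cut_free (f \<theta>))"
| "cut_free (InfNu S d e) = (cut_free d \<and> cut_free e)"
| "cut_free (InfCut d e) = False"

primrec height :: "('s, 't, 'a) deriv \<Rightarrow> enat" where
  "height Inf0 = 1"
| "height (Inf1 d) = eSuc (height d)"
| "height (Inf2 d e) = eSuc (max (height d) (height e))"
| "height (InfNeq U f) = eSuc (SUP \<theta>\<in>U. height (f \<theta>))"
| "height (InfNu S d e) = eSuc (max (height d) (height e))"
| "height (InfCut d e) = eSuc (max (height d) (height e))"

primrec coinvariants :: "('s, 't, 'a) deriv \<Rightarrow> ('s list \<times> ('s, 't, 'a) form) set" where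
  "coinvariants Inf0 = {}"
| "coinvariants (Inf1 d) = coinvariants d"
| "coinvariants (Inf2 d e) = coinvariants d \<union> coinvariants e"
| "coinvariants (InfNeq U f) = (\<Union>\<theta>\<in>U. coinvariants (f \<theta>))"
| "coinvariants (InfNu S d e) = insert S (coinvariants d \<union> coinvariants e)"
| "coinvariants (InfCut d e) = coinvariants d \<union> coinvariants e"

definition quasi_finite :: "('s, 't, 'a) deriv \<Rightarrow> bool" where
  "quasi_finite d \<longleftrightarrow> cut_free d \<and> height d \<noteq> \<infinity> \<and> finite (coinvariants d)"

text \<open>The zone left of the arrow in a focused sequent: \<open>Frozen P\<close> is \<open>P\<^sup>*\<close>.\<close>

datatype ('s, 't, 'a) item = Plain "('s, 't, 'a) form" | Frozen "('s, 't, 'a) form"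

section \<open>The two proof systems\<close>

locale mumall = term_language Tm var tsub
  for Tm :: "'s \<Rightarrow> 't set"
    and var :: "'s \<Rightarrow> nat \<Rightarrow> 't"
    and tsub :: "('s, 't) sbst \<Rightarrow> 't \<Rightarrow> 't" +
  fixes ar :: "'a \<Rightarrow> 's list" \<comment> \<open>the argument sorts of the atoms\<close>
begin

definition well_sorted :: "'t list \<Rightarrow> 's list \<Rightarrow> bool" where
  "well_sorted ts ss \<longleftrightarrow> list_all2 (\<lambda>t s. t \<in> Tm s) ts ss"

text \<open>\<open>wf \<Pi> P\<close>: the formula \<open>P\<close> is well-sorted, with free predicate variables of the arities \<open>\<Pi>\<close>.\<close>

primrec wf :: "'s list list \<Rightarrow> ('s, 't, 'a) form \<Rightarrow> bool" where
  "wf \<Pi> (Tensor P Q) = (wf \<Pi> P \<and> wf \<Pi> Q)"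
| "wf \<Pi> (Par P Q) = (wf \<Pi> P \<and> wf \<Pi> Q)"
| "wf \<Pi> (Plus P Q) = (wf \<Pi> P \<and> wf \<Pi> Q)"
| "wf \<Pi> (With P Q) = (wf \<Pi> P \<and> wf \<Pi> Q)"
| "wf \<Pi> One = True"
| "wf \<Pi> Bot = True"
| "wf \<Pi> Zero = True"
| "wf \<Pi> Top = True"
| "wf \<Pi> (Ex s P) = wf \<Pi> P"
| "wf \<Pi> (All s P) = wf \<Pi> P"
| "wf \<Pi> (Eq s t u) = (t \<in> Tm s \<and> u \<in> Tm s)"
| "wf \<Pi> (Neq s t u) = (t \<in> Tm s \<and> u \<in> Tm s)"
| "wf \<Pi> (Atom a ts) = well_sorted ts (ar a)"
| "wf \<Pi> (NAtom a ts) = well_sorted ts (ar a)"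
| "wf \<Pi> (PVar i ts) = (i < length \<Pi> \<and> well_sorted ts (\<Pi> ! i))"
| "wf \<Pi> (Mu ss B ts) = (wf (ss # \<Pi>) B \<and> well_sorted ts ss)"
| "wf \<Pi> (Nu ss B ts) = (wf (ss # \<Pi>) B \<and> well_sorted ts ss)"

abbreviation formula :: "('s, 't, 'a) form \<Rightarrow> bool" where
  "formula P \<equiv> wf [] P"

primrec fsub :: "('s, 't) sbst \<Rightarrow> ('s, 't, 'a) form \<Rightarrow> ('s, 't, 'a) form" where
  "fsub \<sigma> (Tensor P Q) = Tensor (fsub \<sigma> P) (fsub \<sigma> Q)"
| "fsub \<sigma> (Par P Q) = Par (fsub \<sigma> P) (fsub \<sigma> Q)"
| "fsub \<sigma> (Plus P Q) = Plus (fsub \<sigma> P) (fsub \<sigma> Q)"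
| "fsub \<sigma> (With P Q) = With (fsub \<sigma> P) (fsub \<sigma> Q)"
| "fsub \<sigma> One = One"
| "fsub \<sigma> Bot = Bot"
| "fsub \<sigma> Zero = Zero"
| "fsub \<sigma> Top = Top"
| "fsub \<sigma> (Ex s P) = Ex s (fsub (ups [s] \<sigma>) P)"
| "fsub \<sigma> (All s P) = All s (fsub (ups [s] \<sigma>) P)"
| "fsub \<sigma> (Eq s t u) = Eq s (tsub \<sigma> t) (tsub \<sigma> u)"
| "fsub \<sigma> (Neq s t u) = Neq s (tsub \<sigma> t) (tsub \<sigma> u)"
| "fsub \<sigma> (Atom a ts) = Atom a (map (tsub \<sigma>) ts)"
| "fsub \<sigma> (NAtom a ts) = NAtom a (map (tsub \<sigma>) ts)"
| "fsub \<sigma> (PVar i ts) = PVar i (map (tsub \<sigma>) ts)"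
| "fsub \<sigma> (Mu ss B ts) = Mu ss (fsub (ups ss \<sigma>) B) (map (tsub \<sigma>) ts)"
| "fsub \<sigma> (Nu ss B ts) = Nu ss (fsub (ups ss \<sigma>) B) (map (tsub \<sigma>) ts)"

primrec isub :: "('s, 't) sbst \<Rightarrow> ('s, 't, 'a) item \<Rightarrow> ('s, 't, 'a) item" where
  "isub \<sigma> (Plain P) = Plain (fsub \<sigma> P)"
| "isub \<sigma> (Frozen P) = Frozen (fsub \<sigma> P)"

text \<open>
  A predicate \<open>\<lambda>x\<^sub>1 \<dots> x\<^sub>n. S\<close> is given by the sorts \<open>ss\<close> of the \<open>x\<^sub>i\<close> and the formula \<open>S\<close>.
  \<open>plift ss \<sigma> S\<close> is its image under a substitution of its free term variables, and
  \<open>psub ss k S P\<close> replaces the predicate variable \<open>k\<close> by it in \<open>P\<close>. It is only used for \<open>S\<close>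
  without free predicate variables, so no renumbering of those in \<open>S\<close> is needed.
\<close>

definition plift :: "'s list \<Rightarrow> ('s, 't) sbst \<Rightarrow> ('s, 't, 'a) form \<Rightarrow> ('s, 't, 'a) form" where
  "plift ss \<sigma> S = fsub (ups ss \<sigma>) S"

primrec psub :: "'s list \<Rightarrow> nat \<Rightarrow> ('s, 't, 'a) form \<Rightarrow> ('s, 't, 'a) form \<Rightarrow> ('s, 't, 'a) form" where
  "psub ss k S (Tensor P Q) = Tensor (psub ss k S P) (psub ss k S Q)"
| "psub ss k S (Par P Q) = Par (psub ss k S P) (psub ss k S Q)"
| "psub ss k S (Plus P Q) = Plus (psub ss k S P) (psub ss k S Q)"
| "psub ss k S (With P Q) = With (psub ss k S P) (psub ss k S Q)"
| "psub ss k S One = One"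
| "psub ss k S Bot = Bot"
| "psub ss k S Zero = Zero"
| "psub ss k S Top = Top"
| "psub ss k S (Ex s P) = Ex s (psub ss k (plift ss (shift [s]) S) P)"
| "psub ss k S (All s P) = All s (psub ss k (plift ss (shift [s]) S) P)"
| "psub ss k S (Eq s t u) = Eq s t u"
| "psub ss k S (Neq s t u) = Neq s t u"
| "psub ss k S (Atom a ts) = Atom a ts"
| "psub ss k S (NAtom a ts) = NAtom a ts"
| "psub ss k S (PVar i ts) =
     (if i < k then PVar i ts else if i = k then fsub (inst ss ts) S else PVar (i - 1) ts)"
| "psub ss k S (Mu ss' B ts) = Mu ss' (psub ss (Suc k) (plift ss (shift ss') S) B) ts"
| "psub ss k S (Nu ss' B ts) = Nu ss' (psub ss (Suc k) (plift ss (shift ss') S) B) ts"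

text \<open>
  \<open>B S x\<^sub>1 \<dots> x\<^sub>n\<close> for fresh \<open>x\<^sub>i\<close>, which are the variables bound by \<open>ss\<close> in the body \<open>B\<close>:
  the ambient variables of \<open>S\<close> have to be shifted past them.
\<close>

definition papp :: "'s list \<Rightarrow> ('s, 't, 'a) form \<Rightarrow> ('s, 't, 'a) form \<Rightarrow> ('s, 't, 'a) form" where
  "papp ss B S = psub ss 0 (plift ss (shift ss) S) B"

text \<open>\<open>B (\<mu>B) t\<^sub>1 \<dots> t\<^sub>n\<close>; the predicate \<open>\<mu>B\<close> is written \<open>\<lambda>x\<^sub>1 \<dots> x\<^sub>n. \<mu>B x\<^sub>1 \<dots> x\<^sub>n\<close>.\<close>

definition unfold_mu :: "'s list \<Rightarrow> ('s, 't, 'a) form \<Rightarrow> 't list \<Rightarrow> ('s, 't, 'a) form" where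
  "unfold_mu ss B ts = fsub (inst ss ts) (papp ss B (Mu ss (plift ss (shift ss) B) (bvars ss)))"

text \<open>
  The calculus \<open>\<mu>MALL\<close>: \<open>derives d \<Gamma>\<close> means that \<open>d\<close> is the inference tree of a derivation of
  \<open>\<turnstile> \<Gamma>\<close>. In the premise of a rule introducing eigenvariables the other formulas are
  shifted, so that the eigenvariables (the bound variables of the principal formula) are fresh.
\<close>

inductive derives :: "('s, 't, 'a) deriv \<Rightarrow> ('s, 't, 'a) form multiset \<Rightarrow> bool" where
  init: "derives Inf0 {#P, neg P#}"
| cut: "formula P \<Longrightarrow> derives d (add_mset P \<Gamma>) \<Longrightarrow> derives e (add_mset (neg P) \<Delta>) \<Longrightarrow>
    derives (InfCut d e) (\<Gamma> + \<Delta>)"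
| tensor: "derives d (add_mset P \<Gamma>) \<Longrightarrow> derives e (add_mset Q \<Delta>) \<Longrightarrow>
    derives (Inf2 d e) (add_mset (Tensor P Q) (\<Gamma> + \<Delta>))"
| par: "derives d (add_mset P (add_mset Q \<Gamma>)) \<Longrightarrow> derives (Inf1 d) (add_mset (Par P Q) \<Gamma>)"
| plus1: "derives d (add_mset P \<Gamma>) \<Longrightarrow> derives (Inf1 d) (add_mset (Plus P Q) \<Gamma>)"
| plus2: "derives d (add_mset Q \<Gamma>) \<Longrightarrow> derives (Inf1 d) (add_mset (Plus P Q) \<Gamma>)"
| withr: "derives d (add_mset P \<Gamma>) \<Longrightarrow> derives e (add_mset Q \<Gamma>) \<Longrightarrow>
    derives (Inf2 d e) (add_mset (With P Q) \<Gamma>)"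
| one: "derives Inf0 {#One#}"
| bot: "derives d \<Gamma> \<Longrightarrow> derives (Inf1 d) (add_mset Bot \<Gamma>)"
| top: "derives Inf0 (add_mset Top \<Gamma>)"
| ex: "t \<in> Tm s \<Longrightarrow> derives d (add_mset (fsub (inst [s] [t]) P) \<Gamma>) \<Longrightarrow>
    derives (Inf1 d) (add_mset (Ex s P) \<Gamma>)"
| all: "derives d (add_mset P (image_mset (fsub (shift [s])) \<Gamma>)) \<Longrightarrow>
    derives (Inf1 d) (add_mset (All s P) \<Gamma>)"
| eq: "derives Inf0 {#Eq s t t#}"
| neq: "csu t u U \<Longrightarrow> (\<And>\<theta>. \<theta> \<in> U \<Longrightarrow> derives (f \<theta>) (image_mset (fsub \<theta>) \<Gamma>)) \<Longrightarrow>
    derives (InfNeq U f) (add_mset (Neq s t u) \<Gamma>)"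
| mu: "derives d (add_mset (unfold_mu ss B ts) \<Gamma>) \<Longrightarrow>
    derives (Inf1 d) (add_mset (Mu ss B ts) \<Gamma>)"
| nu: "formula S \<Longrightarrow> derives d (add_mset (fsub (inst ss ts) S) \<Gamma>) \<Longrightarrow>
    derives e {#papp ss B S, neg S#} \<Longrightarrow>
    derives (InfNu (ss, S) d e) (add_mset (Nu ss B ts) \<Gamma>)"

definition provable :: "('s, 't, 'a) form multiset \<Rightarrow> bool" where
  "provable \<Gamma> \<longleftrightarrow> (\<exists>d. derives d \<Gamma>)"

text \<open>
  The \<open>\<nu>\<close>-focused system: \<open>foc_up \<Gamma> \<Delta>\<close> is \<open>\<turnstile> \<Gamma> \<Up> \<Delta>\<close> and \<open>foc_dn \<Gamma> P\<close> is \<open>\<turnstile> \<Gamma> \<Down> P\<close>.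
\<close>

inductive foc_up :: "('s, 't, 'a) item multiset \<Rightarrow> ('s, 't, 'a) form multiset \<Rightarrow> bool"
  and foc_dn :: "('s, 't, 'a) item multiset \<Rightarrow> ('s, 't, 'a) form \<Rightarrow> bool" where
  par_up: "foc_up \<Gamma> (add_mset P (add_mset Q \<Delta>)) \<Longrightarrow> foc_up \<Gamma> (add_mset (Par P Q) \<Delta>)"
| bot_up: "foc_up \<Gamma> \<Delta> \<Longrightarrow> foc_up \<Gamma> (add_mset Bot \<Delta>)"
| with_up: "foc_up \<Gamma> (add_mset P \<Delta>) \<Longrightarrow> foc_up \<Gamma> (add_mset Q \<Delta>) \<Longrightarrow>
    foc_up \<Gamma> (add_mset (With P Q) \<Delta>)"
| top_up: "foc_up \<Gamma> (add_mset Top \<Delta>)"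
| all_up: "foc_up (image_mset (isub (shift [s])) \<Gamma>)
      (add_mset P (image_mset (fsub (shift [s])) \<Delta>)) \<Longrightarrow>
    foc_up \<Gamma> (add_mset (All s P) \<Delta>)"
| neq_up: "csu t u U \<Longrightarrow>
    (\<And>\<theta>. \<theta> \<in> U \<Longrightarrow> foc_up (image_mset (isub \<theta>) \<Gamma>) (image_mset (fsub \<theta>) \<Delta>)) \<Longrightarrow>
    foc_up \<Gamma> (add_mset (Neq s t u) \<Delta>)"
| natom_freeze: "foc_up (add_mset (Frozen (NAtom a ts)) \<Gamma>) \<Delta> \<Longrightarrow>
    foc_up \<Gamma> (add_mset (NAtom a ts) \<Delta>)"
| mu_unfold: "foc_up \<Gamma> (add_mset (unfold_mu ss B ts) \<Delta>) \<Longrightarrow>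
    foc_up \<Gamma> (add_mset (Mu ss B ts) \<Delta>)"
| mu_freeze: "foc_up (add_mset (Frozen (Mu ss B ts)) \<Gamma>) \<Delta> \<Longrightarrow>
    foc_up \<Gamma> (add_mset (Mu ss B ts) \<Delta>)"
| tensor_dn: "foc_dn \<Gamma> P \<Longrightarrow> foc_dn \<Gamma>' Q \<Longrightarrow> foc_dn (\<Gamma> + \<Gamma>') (Tensor P Q)"
| one_dn: "foc_dn {#} One"
| plus1_dn: "foc_dn \<Gamma> P \<Longrightarrow> foc_dn \<Gamma> (Plus P Q)"
| plus2_dn: "foc_dn \<Gamma> Q \<Longrightarrow> foc_dn \<Gamma> (Plus P Q)"
| ex_dn: "t \<in> Tm s \<Longrightarrow> foc_dn \<Gamma> (fsub (inst [s] [t]) P) \<Longrightarrow> foc_dn \<Gamma> (Ex s P)"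
| eq_dn: "foc_dn {#} (Eq s t t)"
| atom_dn: "foc_dn {#Frozen (NAtom a ts)#} (Atom a ts)"
| nu_coind: "formula S \<Longrightarrow> foc_dn \<Gamma> (fsub (inst ss ts) S) \<Longrightarrow>
    foc_up {#} {#papp ss B S, neg S#} \<Longrightarrow> foc_dn \<Gamma> (Nu ss B ts)"
| nu_ax: "foc_dn {#Frozen (Mu ss (neg B) ts)#} (Nu ss B ts)"
| store: "\<not> async P \<Longrightarrow> foc_up (add_mset (Plain P) \<Gamma>) \<Delta> \<Longrightarrow> foc_up \<Gamma> (add_mset P \<Delta>)"
| focus: "\<not> async P \<Longrightarrow> foc_dn \<Gamma> P \<Longrightarrow> foc_up (add_mset (Plain P) \<Gamma>) {#}"
| release: "async P \<Longrightarrow> foc_up \<Gamma> {#P#} \<Longrightarrow> foc_dn \<Gamma> P"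

end

section \<open>Term languages: instances\<close>

subsection \<open>First-order terms\<close>

datatype ('s, 'f) fot = FVar 's nat | Fun 'f "('s, 'f) fot list"

inductive fot_sort :: "('f \<Rightarrow> 's list \<times> 's) \<Rightarrow> 's \<Rightarrow> ('s, 'f) fot \<Rightarrow> bool" for sig where
  "fot_sort sig s (FVar s j)"
| "list_all2 (fot_sort sig) (fst (sig f)) ts \<Longrightarrow> fot_sort sig (snd (sig f)) (Fun f ts)"

primrec fot_sub :: "('s, ('s, 'f) fot) sbst \<Rightarrow> ('s, 'f) fot \<Rightarrow> ('s, 'f) fot" where
  "fot_sub \<sigma> (FVar s j) = \<sigma> s j"
| "fot_sub \<sigma> (Fun f ts) = Fun f (map (fot_sub \<sigma>) ts)"

lemma term_language_fot: "term_language (\<lambda>s. {t. fot_sort sig s t}) FVar fot_sub"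
proof
  fix \<sigma> :: "('a, ('a, 'b) fot) sbst" and t s
  assume \<sigma>: "\<And>s j. \<sigma> s j \<in> {t. fot_sort sig s t}" and t: "t \<in> {t. fot_sort sig s t}"
  have "fot_sort sig s t \<Longrightarrow> fot_sort sig s (fot_sub \<sigma> t)"
  proof (induction rule: fot_sort.induct)
    case (2 f ts)
    then have "list_all2 (fot_sort sig) (fst (sig f)) (map (fot_sub \<sigma>) ts)"
      by (auto simp: list.rel_map elim: list_all2_mono)
    then show ?case by (auto intro: fot_sort.intros)
  qed (use \<sigma> in auto)
  with t show "fot_sub \<sigma> t \<in> {t. fot_sort sig s t}" by simp
next
  fix t :: "('a, 'b) fot"
  show "fot_sub FVar t = t" by (induction t) (auto simp: map_idI)
next
  fix \<sigma> \<tau> :: "('a, ('a, 'b) fot) sbst" and t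
  show "fot_sub \<tau> (fot_sub \<sigma> t) = fot_sub (\<lambda>s j. fot_sub \<tau> (\<sigma> s j)) t"
    by (induction t) auto
qed (auto intro: fot_sort.intros)

subsection \<open>Simply typed lambda-terms modulo beta-eta\<close>

datatype 'b ty = Base 'b | Arrow "'b ty" "'b ty"

datatype ('b, 'c) lam =
  LVar "'b ty" nat | LCon 'c | LApp "('b, 'c) lam" "('b, 'c) lam" | LAbs "'b ty" "('b, 'c) lam"

definition rup :: "'b ty \<Rightarrow> ('b ty \<Rightarrow> nat \<Rightarrow> nat) \<Rightarrow> 'b ty \<Rightarrow> nat \<Rightarrow> nat" where
  "rup T r = (\<lambda>T' j. if T' = T then (case j of 0 \<Rightarrow> 0 | Suc i \<Rightarrow> Suc (r T i)) else r T' j)"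

primrec lren :: "('b ty \<Rightarrow> nat \<Rightarrow> nat) \<Rightarrow> ('b, 'c) lam \<Rightarrow> ('b, 'c) lam" where
  "lren r (LVar T j) = LVar T (r T j)"
| "lren r (LCon c) = LCon c"
| "lren r (LApp t u) = LApp (lren r t) (lren r u)"
| "lren r (LAbs T t) = LAbs T (lren (rup T r) t)"

definition rsh :: "'b ty \<Rightarrow> 'b ty \<Rightarrow> nat \<Rightarrow> nat" where
  "rsh T = (\<lambda>T' j. if T' = T then Suc j else j)"

definition lscons :: "'b ty \<Rightarrow> ('b, 'c) lam \<Rightarrow> ('b ty, ('b, 'c) lam) sbst \<Rightarrow> ('b ty, ('b, 'c) lam) sbst"
  where "lscons T t \<sigma> = (\<lambda>T' j. if T' = T then (case j of 0 \<Rightarrow> t | Suc i \<Rightarrow> \<sigma> T i) else \<sigma> T' j)"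

definition lup :: "'b ty \<Rightarrow> ('b ty, ('b, 'c) lam) sbst \<Rightarrow> ('b ty, ('b, 'c) lam) sbst" where
  "lup T \<sigma> = lscons T (LVar T 0) (\<lambda>T' j. lren (rsh T) (\<sigma> T' j))"

primrec lsub :: "('b ty, ('b, 'c) lam) sbst \<Rightarrow> ('b, 'c) lam \<Rightarrow> ('b, 'c) lam" where
  "lsub \<sigma> (LVar T j) = \<sigma> T j"
| "lsub \<sigma> (LCon c) = LCon c"
| "lsub \<sigma> (LApp t u) = LApp (lsub \<sigma> t) (lsub \<sigma> u)"
| "lsub \<sigma> (LAbs T t) = LAbs T (lsub (lup T \<sigma>) t)"

inductive typed :: "('c \<Rightarrow> 'b ty) \<Rightarrow> ('b, 'c) lam \<Rightarrow> 'b ty \<Rightarrow> bool" for sig where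
  "typed sig (LVar T j) T"
| "typed sig (LCon c) (sig c)"
| "typed sig t (Arrow T U) \<Longrightarrow> typed sig u T \<Longrightarrow> typed sig (LApp t u) U"
| "typed sig t U \<Longrightarrow> typed sig (LAbs T t) (Arrow T U)"

inductive conv :: "('c \<Rightarrow> 'b ty) \<Rightarrow> ('b, 'c) lam \<Rightarrow> ('b, 'c) lam \<Rightarrow> 'b ty \<Rightarrow> bool" for sig where
  c_refl: "typed sig t T \<Longrightarrow> conv sig t t T"
| c_sym: "conv sig t u T \<Longrightarrow> conv sig u t T"
| c_trans: "conv sig t u T \<Longrightarrow> conv sig u v T \<Longrightarrow> conv sig t v T"
| c_app: "conv sig t t' (Arrow T U) \<Longrightarrow> conv sig u u' T \<Longrightarrow> conv sig (LApp t u) (LApp t' u') U"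
| c_abs: "conv sig t t' U \<Longrightarrow> conv sig (LAbs T t) (LAbs T t') (Arrow T U)"
| c_beta: "typed sig t U \<Longrightarrow> typed sig u T \<Longrightarrow>
    conv sig (LApp (LAbs T t) u) (lsub (lscons T u LVar) t) U"
| c_eta: "typed sig t (Arrow T U) \<Longrightarrow>
    conv sig (LAbs T (LApp (lren (rsh T) t) (LVar T 0))) t (Arrow T U)"

text \<open>Terms are conversion classes; a substitution acts on classes through representatives.\<close>

definition lclass :: "('c \<Rightarrow> 'b ty) \<Rightarrow> ('b, 'c) lam \<Rightarrow> ('b, 'c) lam set" where
  "lclass sig t = {u. \<exists>T. conv sig t u T}"

definition lrep :: "('b, 'c) lam set \<Rightarrow> ('b, 'c) lam" where
  "lrep C = (SOME t. t \<in> C)"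

definition lTm :: "('c \<Rightarrow> 'b ty) \<Rightarrow> 'b ty \<Rightarrow> ('b, 'c) lam set set" where
  "lTm sig T = {lclass sig t | t. typed sig t T}"

definition lcsub :: "('c \<Rightarrow> 'b ty) \<Rightarrow> ('b ty, ('b, 'c) lam set) sbst \<Rightarrow> ('b, 'c) lam set \<Rightarrow> ('b, 'c) lam set"
  where "lcsub sig \<sigma> C = lclass sig (lsub (\<lambda>T j. lrep (\<sigma> T j)) (lrep C))"

lemma lren_lren: "lren r (lren q t) = lren (\<lambda>T j. r T (q T j)) t"
proof (induction t arbitrary: r q)
  case (LAbs T t)
  have "(\<lambda>T' j. rup T r T' (rup T q T' j)) = rup T (\<lambda>T j. r T (q T j))"
    by (auto simp: rup_def fun_eq_iff split: nat.splits)
  with LAbs show ?case by simp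
qed auto

lemma lsub_lren: "lsub \<sigma> (lren r t) = lsub (\<lambda>T j. \<sigma> T (r T j)) t"
proof (induction t arbitrary: r \<sigma>)
  case (LAbs T t)
  have "(\<lambda>T' j. lup T \<sigma> T' (rup T r T' j)) = lup T (\<lambda>T j. \<sigma> T (r T j))"
    by (auto simp: rup_def lup_def lscons_def fun_eq_iff split: nat.splits)
  with LAbs show ?case by simp
qed auto

lemma lren_lsub: "lren r (lsub \<sigma> t) = lsub (\<lambda>T j. lren r (\<sigma> T j)) t"
proof (induction t arbitrary: r \<sigma>)
  case (LAbs T t)
  have "(\<lambda>T' j. rup T r T' (rsh T T' j)) = (\<lambda>T' j. rsh T T' (r T' j))"
    by (auto simp: rup_def rsh_def fun_eq_iff)
  then have "(\<lambda>T' j. lren (rup T r) (lup T \<sigma> T' j)) = lup T (\<lambda>T j. lren r (\<sigma> T j))"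
    by (auto simp: lup_def lscons_def fun_eq_iff lren_lren rup_def split: nat.splits)
  with LAbs show ?case by simp
qed auto

lemma lup_lsub: "(\<lambda>T' j. lsub (lup T \<tau>) (lup T \<sigma> T' j)) = lup T (\<lambda>T' j. lsub \<tau> (\<sigma> T' j))"
proof -
  have "(\<lambda>T' j. lup T \<tau> T' (rsh T T' j)) = (\<lambda>T' j. lren (rsh T) (\<tau> T' j))"
    by (auto simp: lup_def lscons_def rsh_def fun_eq_iff)
  then show ?thesis
    by (auto simp: lup_def[of T \<sigma>] lup_def[of T "\<lambda>T' j. lsub \<tau> (\<sigma> T' j)"] lscons_def fun_eq_iff
        lsub_lren lren_lsub split: nat.splits) (auto simp: lup_def lscons_def)
qed

lemma lsub_lsub: "lsub \<tau> (lsub \<sigma> t) = lsub (\<lambda>T j. lsub \<tau> (\<sigma> T j)) t"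
  by (induction t arbitrary: \<tau> \<sigma>) (auto simp: lup_lsub)

lemma lsub_LVar: "lsub LVar t = t" for t :: "('a, 'b) lam"
proof (induction t)
  case (LAbs T t)
  have "lup T LVar = (LVar :: ('a ty, ('a, 'b) lam) sbst)"
    by (auto simp: lup_def lscons_def rsh_def fun_eq_iff split: nat.splits)
  with LAbs show ?case by simp
qed auto

lemma typed_lren: "typed sig t T \<Longrightarrow> typed sig (lren r t) T"
  by (induction arbitrary: r rule: typed.induct) (auto intro: typed.intros)

lemma typed_lup: "(\<And>T j. typed sig (\<sigma> T j) T) \<Longrightarrow> typed sig (lup U \<sigma> T j) T"
  by (auto simp: lup_def lscons_def intro: typed.intros typed_lren split: nat.splits)

lemma typed_lsub: "typed sig t T \<Longrightarrow> (\<And>T j. typed sig (\<sigma> T j) T) \<Longrightarrow> typed sig (lsub \<sigma> t) T"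
proof (induction arbitrary: \<sigma> rule: typed.induct)
  case (4 t U T)
  then show ?case by (simp add: typed.intros(4) typed_lup)
qed (auto intro: typed.intros)

inductive_cases typed_elims:
  "typed sig (LVar T j) U" "typed sig (LCon c) U" "typed sig (LApp t u) U" "typed sig (LAbs T t) U"

lemma typed_unique: "typed sig t T \<Longrightarrow> typed sig t U \<Longrightarrow> T = U"
  by (induction arbitrary: U rule: typed.induct) (blast elim: typed_elims)+

lemma conv_typed: "conv sig t u T \<Longrightarrow> typed sig t T \<and> typed sig u T"
proof (induction rule: conv.induct)
  case (c_beta t U u T)
  then have "typed sig (lsub (lscons T u LVar) t) U"
    by (intro typed_lsub) (auto simp: lscons_def intro: typed.intros split: nat.splits)
  with c_beta show ?case by (auto intro: typed.intros)
qed (auto intro: typed.intros typed_lren)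

lemma lscons_simps:
  "lscons T t \<sigma> T 0 = t" "lscons T t \<sigma> T (Suc i) = \<sigma> T i" "T' \<noteq> T \<Longrightarrow> lscons T t \<sigma> T' j = \<sigma> T' j"
  by (auto simp: lscons_def)

lemma lsub_rsh: "lsub (lscons T u LVar) (lren (rsh T) t) = t"
proof -
  have "(\<lambda>T' j. lscons T u LVar T' (rsh T T' j)) = LVar"
    by (auto simp: lscons_def rsh_def fun_eq_iff)
  then show ?thesis by (simp add: lsub_lren lsub_LVar)
qed

lemma conv_lsub: "conv sig t u T \<Longrightarrow> (\<And>T j. typed sig (\<sigma> T j) T) \<Longrightarrow>
  conv sig (lsub \<sigma> t) (lsub \<sigma> u) T"
proof (induction arbitrary: \<sigma> rule: conv.induct)
  case (c_beta t U u T)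
  have "lsub (lscons T (lsub \<sigma> u) LVar) (lup T \<sigma> T' j) = lsub \<sigma> (lscons T u LVar T' j)" for T' j
    unfolding lup_def
    by (cases "T' = T"; cases j) (simp_all add: lsub_rsh lscons_simps)
  then have "lsub (lscons T (lsub \<sigma> u) LVar) (lsub (lup T \<sigma>) t) = lsub \<sigma> (lsub (lscons T u LVar) t)"
    by (simp add: lsub_lsub)
  moreover have "typed sig (lsub (lup T \<sigma>) t) U" "typed sig (lsub \<sigma> u) T"
    using c_beta by (auto intro: typed_lsub typed_lup)
  ultimately show ?case using conv.c_beta by fastforce
next
  case (c_eta t T U)
  have "lsub (lup T \<sigma>) (lren (rsh T) t) = lren (rsh T) (lsub \<sigma> t)"
    unfolding lsub_lren lren_lsub
    by (rule arg_cong[where f = "\<lambda>s. lsub s t"]) (auto simp: lup_def lscons_def rsh_def fun_eq_iff)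
  moreover have "lup T \<sigma> T 0 = LVar T 0" by (simp add: lup_def lscons_def)
  ultimately show ?case using c_eta by (auto intro: conv.c_eta typed_lsub)
next
  case (c_abs t t' U T)
  then show ?case by (simp add: conv.c_abs typed_lup)
next
  case (c_app t t' T U u u')
  show ?case unfolding lsub.simps
    by (rule conv.c_app[OF c_app.IH(1)[OF c_app.prems] c_app.IH(2)[OF c_app.prems]])
qed (auto intro: conv.intros typed_lsub)

lemma conv_lren:
  fixes t :: "('a, 'b) lam"
  shows "conv sig t u T \<Longrightarrow> conv sig (lren r t) (lren r u) T"
proof -
  have *: "lren r t = lsub (\<lambda>T j. LVar T (r T j)) t" for t :: "('a, 'b) lam"
    using lren_lsub[of r LVar t] by (simp add: lsub_LVar)
  show "conv sig t u T \<Longrightarrow> conv sig (lren r t) (lren r u) T"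
    unfolding * by (rule conv_lsub) (auto intro: typed.intros)
qed

lemma conv_lsub2: "typed sig t T \<Longrightarrow> (\<And>T j. conv sig (\<sigma> T j) (\<tau> T j) T) \<Longrightarrow>
  conv sig (lsub \<sigma> t) (lsub \<tau> t) T"
proof (induction arbitrary: \<sigma> \<tau> rule: typed.induct)
  case (4 t U T)
  have "conv sig (lup T \<sigma> T' j) (lup T \<tau> T' j) T'" for T' j
    using 4 by (auto simp: lup_def lscons_def intro: conv_lren conv.intros typed.intros split: nat.splits)
  with 4 show ?case by (auto intro: conv.intros)
next
  case (3 t T U u)
  show ?case unfolding lsub.simps by (rule c_app[OF "3.IH"(1)[OF "3.prems"] "3.IH"(2)[OF "3.prems"]])
qed (auto intro: conv.intros typed.intros)

lemma lclass_eq: "conv sig t u T \<Longrightarrow> lclass sig t = lclass sig u"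
  unfolding lclass_def by (blast dest: conv_typed typed_unique intro: c_sym c_trans)

lemma conv_lrep: assumes "typed sig t T" shows "conv sig t (lrep (lclass sig t)) T"
proof -
  have "t \<in> lclass sig t" using assms by (auto simp: lclass_def intro: c_refl)
  then have "lrep (lclass sig t) \<in> lclass sig t" unfolding lrep_def by (rule someI)
  then show ?thesis using assms by (auto simp: lclass_def dest: conv_typed typed_unique)
qed

lemma typed_lrep: "C \<in> lTm sig T \<Longrightarrow> typed sig (lrep C) T \<and> lclass sig (lrep C) = C"
  unfolding lTm_def by (auto dest: conv_lrep conv_typed lclass_eq)

lemma term_language_lam:
  fixes sig :: "'b \<Rightarrow> 'a ty"
  shows "term_language (lTm sig) (\<lambda>T j. lclass sig (LVar T j)) (lcsub sig)"
proof
  fix T j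
  show "lclass sig (LVar T j) \<in> lTm sig T" unfolding lTm_def by (auto intro: typed.intros)
next
  fix \<sigma> :: "('a ty, ('a, 'b) lam set) sbst" and C T
  assume "\<And>T j. \<sigma> T j \<in> lTm sig T" "C \<in> lTm sig T"
  then have "typed sig (lsub (\<lambda>T j. lrep (\<sigma> T j)) (lrep C)) T"
    using typed_lrep by (intro typed_lsub) blast+
  then show "lcsub sig \<sigma> C \<in> lTm sig T"
    unfolding lcsub_def lTm_def by blast
next
  fix \<sigma> :: "('a ty, ('a, 'b) lam set) sbst" and T j
  assume \<sigma>: "\<And>T j. \<sigma> T j \<in> lTm sig T"
  have "conv sig (LVar T j) (lrep (lclass sig (LVar T j))) T"
    by (intro conv_lrep typed.intros)
  then have "conv sig (lrep (\<sigma> T j)) (lsub (\<lambda>T j. lrep (\<sigma> T j)) (lrep (lclass sig (LVar T j)))) T"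
    using conv_lsub[of sig "LVar T j" _ T "\<lambda>T j. lrep (\<sigma> T j)"] typed_lrep[OF \<sigma>] by simp
  then show "lcsub sig \<sigma> (lclass sig (LVar T j)) = \<sigma> T j"
    unfolding lcsub_def using lclass_eq typed_lrep[OF \<sigma>] by metis
next
  fix C T assume C: "C \<in> lTm sig T"
  have "conv sig (lsub LVar (lrep C)) (lsub (\<lambda>T j. lrep (lclass sig (LVar T j))) (lrep C)) T"
    using typed_lrep[OF C] by (intro conv_lsub2) (auto intro: conv_lrep typed.intros)
  then show "lcsub sig (\<lambda>T j. lclass sig (LVar T j)) C = C"
    unfolding lcsub_def lsub_LVar using lclass_eq typed_lrep[OF C] by metis
next
  fix \<sigma> \<tau> :: "('a ty, ('a, 'b) lam set) sbst" and C T
  assume \<sigma>: "\<And>T j. \<sigma> T j \<in> lTm sig T" and \<tau>: "\<And>T j. \<tau> T j \<in> lTm sig T"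
    and C: "C \<in> lTm sig T"
  let ?s = "\<lambda>T j. lrep (\<sigma> T j)" and ?t = "\<lambda>T j. lrep (\<tau> T j)"
  have s: "typed sig (?s T j) T" and t: "typed sig (?t T j) T" for T j
    using typed_lrep \<sigma> \<tau> by blast+
  have c: "typed sig (lrep C) T" using typed_lrep[OF C] ..
  have "conv sig (lsub ?t (lsub ?s (lrep C))) (lsub ?t (lrep (lcsub sig \<sigma> C))) T"
    unfolding lcsub_def by (intro conv_lsub conv_lrep typed_lsub c s t)
  moreover have "conv sig (lsub (\<lambda>T j. lsub ?t (?s T j)) (lrep C))
      (lsub (\<lambda>T j. lrep (lcsub sig \<tau> (\<sigma> T j))) (lrep C)) T"
    unfolding lcsub_def by (intro conv_lsub2 conv_lrep typed_lsub c s t)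
  ultimately show "lcsub sig \<tau> (lcsub sig \<sigma> C) = lcsub sig (\<lambda>T j. lcsub sig \<tau> (\<sigma> T j)) C"
    unfolding lcsub_def[of sig \<tau> "lcsub sig \<sigma> C"] lcsub_def[of sig "\<lambda>T j. lcsub sig \<tau> (\<sigma> T j)"]
    using lclass_eq lsub_lsub by metis
qed

end

theory Submission
  imports Defs
begin

text \<open>
  Soundness forgets the focusing annotations. For completeness, take a cut-free derivation of height
  at most \<open>n\<close>. Along any branch it unfolds at most \<open>n\<close> times, so in the asynchronous phase it is enough
  to unfold every least fixed point \<open>n\<close> times and then to freeze it; every sequence of leaves of this
  phase turns out to be provable, by induction on the derivation.

  A synchronous rule applied to \<open>A\<close> is permuted down by substitution: in a focused derivation a
  stored \<open>A\<close> is only ever consumed by focusing on it, hence can be replaced by any context that is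
  provable together with each context proving \<open>A\<close> under focus.

  In an identity \<open>P, P\<^sup>\<bottom>\<close> the leaves of \<open>P\<close> must prove \<open>P\<^sup>\<bottom>\<close> under focus. After unfolding \<open>\<mu>B t\<close> the
  axiom no longer applies to \<open>(\<mu>B t)\<^sup>\<bottom>\<close>; one coinducts with the coinvariant \<open>(B (\<mu>B))\<^sup>\<bottom>\<close> instead,
  whose invariance is an instance of the functoriality of operators.
\<close>

section \<open>Calculus of substitutions\<close>

context mumall
begin

text \<open>Unfolding spends only the fuel of the formula being unfolded, whereas the height bound
  drops for the whole sequent. Each formula of a sequent therefore carries its own fuel, required
  only to be at least the current bound, and the induction hypothesis applies at the smaller bound.
  Since the rule for \<noteq> may have infinitely many premises, it is a bound uniform over all
  branches that supplies one \<open>n\<close> for the entire tree. Eigenvariables and unifiers are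
  the second obstacle: the premises of \<forall> and \<noteq> see the context only under a
  substitution. The auxiliary notions are therefore quantified over substitutions, and a leaf
  records arbitrary instances, so that no freshness has to be tracked. Identity expansion seems
  circular, since unfolding enlarges formulas. The axiom for frozen formulas breaks the circle: it
  links a least fixed point to its dual without looking into the operator, so functoriality can be
  proved by structural induction on operator bodies.\<close>

definition scomp :: "('s, 't) sbst \<Rightarrow> ('s, 't) sbst \<Rightarrow> ('s, 't) sbst" where
  "scomp \<sigma> \<tau> = (\<lambda>s j. tsub \<tau> (\<sigma> s j))"

text \<open>Both \<open>inst\<close> and \<open>ups\<close> have this form
  (\<open>inst_sconss\<close>, \<open>ups_sconss\<close>), so that their compositions are all
  computed by \<open>scomp_sconss\<close>. In \<open>scomp\<close> the left substitution acts
  first.\<close>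

primrec sconss :: "'s list \<Rightarrow> 't list \<Rightarrow> ('s, 't) sbst \<Rightarrow> ('s, 't) sbst" where
  "sconss [] ts \<sigma> = \<sigma>"
| "sconss (s # ss) ts \<sigma> = scons s (hd ts) (sconss ss (tl ts) \<sigma>)"

lemma is_sbst_var [simp]: "is_sbst var"
  by (simp add: is_sbst_def var_Tm)

lemma is_sbst_shift [simp]: "is_sbst (shift ss)"
  by (simp add: is_sbst_def shift_def var_Tm)

lemma is_sbst_scons [simp]: "t \<in> Tm s \<Longrightarrow> is_sbst \<sigma> \<Longrightarrow> is_sbst (scons s t \<sigma>)"
  by (auto simp: is_sbst_def scons_def split: nat.split)

lemma is_sbst_Tm: "is_sbst \<sigma> \<Longrightarrow> t \<in> Tm s \<Longrightarrow> tsub \<sigma> t \<in> Tm s"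
  by (simp add: is_sbst_def tsub_Tm)

lemma is_sbst_scomp [simp]: "is_sbst \<sigma> \<Longrightarrow> is_sbst \<tau> \<Longrightarrow> is_sbst (scomp \<sigma> \<tau>)"
  by (simp add: is_sbst_def scomp_def tsub_Tm)

lemma tsub_var' [simp]: "is_sbst \<sigma> \<Longrightarrow> tsub \<sigma> (var s j) = \<sigma> s j"
  by (simp add: is_sbst_def tsub_var)

lemma tsub_scomp: "is_sbst \<sigma> \<Longrightarrow> is_sbst \<tau> \<Longrightarrow> t \<in> Tm s \<Longrightarrow> tsub \<tau> (tsub \<sigma> t) = tsub (scomp \<sigma> \<tau>) t"
  unfolding is_sbst_def scomp_def by (rule tsub_tsub) auto

lemma scomp_assoc:
  "is_sbst \<sigma> \<Longrightarrow> is_sbst \<tau> \<Longrightarrow> is_sbst \<rho> \<Longrightarrow> scomp (scomp \<sigma> \<tau>) \<rho> = scomp \<sigma> (scomp \<tau> \<rho>)"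
proof (intro ext)
  fix s j assume "is_sbst \<sigma>" "is_sbst \<tau>" "is_sbst \<rho>"
  then show "scomp (scomp \<sigma> \<tau>) \<rho> s j = scomp \<sigma> (scomp \<tau> \<rho>) s j"
    using tsub_scomp[of \<tau> \<rho> "\<sigma> s j" s] by (simp add: scomp_def is_sbst_def)
qed

lemma scomp_var_left [simp]: "is_sbst \<sigma> \<Longrightarrow> scomp var \<sigma> = \<sigma>"
  by (intro ext) (simp add: scomp_def)

lemma scomp_var_right [simp]: "is_sbst \<sigma> \<Longrightarrow> scomp \<sigma> var = \<sigma>"
  by (intro ext) (auto simp: scomp_def is_sbst_def intro: tsub_id)

lemma scomp_scons: "scomp (scons s t \<sigma>) \<tau> = scons s (tsub \<tau> t) (scomp \<sigma> \<tau>)"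
  by (intro ext) (simp add: scomp_def scons_def split: nat.split)

lemma scomp_sconss:
  "length ts = length ss \<Longrightarrow>
    scomp (sconss ss ts \<sigma>) \<tau> = sconss ss (map (tsub \<tau>) ts) (scomp \<sigma> \<tau>)"
proof (induction ss arbitrary: ts)
  case (Cons s ss)
  then show ?case by (cases ts) (simp_all add: scomp_scons)
qed simp

lemma shift_scons: "is_sbst \<sigma> \<Longrightarrow> t \<in> Tm s \<Longrightarrow> scomp (shift [s]) (scons s t \<sigma>) = \<sigma>"
  by (intro ext) (simp add: scomp_def shift_def, auto simp: scons_def)

lemma shift_Nil [simp]: "shift [] = var"
  by (simp add: shift_def)

lemma shift_Cons: "shift (s # ss) = scomp (shift ss) (shift [s])"
  by (intro ext) (simp add: scomp_def shift_def[of ss], simp add: shift_def)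

lemma inst_sconss: "inst ss ts = sconss ss ts var"
  by (induction ss arbitrary: ts) simp_all

lemma well_sorted_length: "well_sorted ts ss \<Longrightarrow> length ts = length ss"
  by (auto simp: well_sorted_def dest: list_all2_lengthD)

lemma is_sbst_sconss [simp]: "well_sorted ts ss \<Longrightarrow> is_sbst \<sigma> \<Longrightarrow> is_sbst (sconss ss ts \<sigma>)"
proof (induction ss arbitrary: ts)
  case (Cons s ss)
  then show ?case by (cases ts) (simp_all add: well_sorted_def)
qed simp

lemma is_sbst_inst [simp]: "well_sorted ts ss \<Longrightarrow> is_sbst (inst ss ts)"
  by (simp add: inst_sconss)

lemma well_sorted_map [simp]: "well_sorted ts ss \<Longrightarrow> is_sbst \<sigma> \<Longrightarrow> well_sorted (map (tsub \<sigma>) ts) ss"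
  by (auto simp: well_sorted_def list.rel_map is_sbst_Tm elim: list_all2_mono)

lemma map_tsub_tsub:
  "well_sorted ts ss \<Longrightarrow> is_sbst \<sigma> \<Longrightarrow> is_sbst \<tau> \<Longrightarrow>
    map (tsub \<tau>) (map (tsub \<sigma>) ts) = map (tsub (scomp \<sigma> \<tau>)) ts"
  unfolding well_sorted_def
  by (induction ts ss rule: list_all2_induct) (auto intro: tsub_scomp)

lemma map_tsub_var: "well_sorted ts ss \<Longrightarrow> map (tsub var) ts = ts"
  unfolding well_sorted_def by (induction ts ss rule: list_all2_induct) (auto intro: tsub_id)

lemma shift_sconss:
  "well_sorted ts ss \<Longrightarrow> is_sbst \<sigma> \<Longrightarrow> scomp (shift ss) (sconss ss ts \<sigma>) = \<sigma>"
proof (induction ss arbitrary: ts)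
  case (Cons s ss)
  then obtain t ts' where "ts = t # ts'" "t \<in> Tm s" "well_sorted ts' ss"
    by (cases ts) (auto simp: well_sorted_def)
  with Cons show ?case by (simp add: shift_Cons[of s ss] scomp_assoc shift_scons)
qed simp

lemma bvars_well_sorted [simp]: "well_sorted (bvars ss) ss"
proof (induction ss)
  case (Cons s ss)
  then have "well_sorted (map (tsub (shift [s])) (bvars ss)) ss" by simp
  then show ?case by (simp add: well_sorted_def var_Tm)
qed (simp add: well_sorted_def)

lemma length_bvars [simp]: "length (bvars ss) = length ss"
  by (simp add: well_sorted_length)

lemma bvars_sconss:
  "well_sorted ts ss \<Longrightarrow> is_sbst \<sigma> \<Longrightarrow> map (tsub (sconss ss ts \<sigma>)) (bvars ss) = ts"
proof (induction ss arbitrary: ts)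
  case (Cons s ss)
  then obtain t ts' where ts: "ts = t # ts'" "t \<in> Tm s" "well_sorted ts' ss"
    by (cases ts) (auto simp: well_sorted_def)
  then have "map (tsub (sconss (s # ss) ts \<sigma>)) (map (tsub (shift [s])) (bvars ss)) = ts'"
    using Cons by (subst map_tsub_tsub[of _ ss]) (simp_all add: shift_scons)
  moreover have "tsub (sconss (s # ss) ts \<sigma>) (var s 0) = t"
    using ts Cons by simp (simp add: scons_def)
  ultimately show ?case using ts by simp
qed (simp add: well_sorted_def)

lemma ups_sconss: "is_sbst \<sigma> \<Longrightarrow> ups ss \<sigma> = sconss ss (bvars ss) (scomp \<sigma> (shift ss))"
proof (induction ss)
  case (Cons s ss)
  have "ups (s # ss) \<sigma> = scons s (var s 0) (scomp (ups ss \<sigma>) (shift [s]))"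
    by (simp add: scomp_def)
  with Cons show ?case by (simp add: scomp_sconss shift_Cons[of s ss] scomp_assoc)
qed simp

lemma is_sbst_ups [simp]: "is_sbst \<sigma> \<Longrightarrow> is_sbst (ups ss \<sigma>)"
  by (simp add: ups_sconss)

text \<open>Any substitution acting below the binders \<open>ss\<close> splits into its values on
  the bound variables and its action on the shifted ones. An arbitrary instance of a premise with
  eigenvariables thus reads as a choice of terms for them.\<close>

lemma sconss_eta:
  "is_sbst \<sigma> \<Longrightarrow> sconss ss (map (tsub \<sigma>) (bvars ss)) (scomp (shift ss) \<sigma>) = \<sigma>"
proof (induction ss arbitrary: \<sigma>)
  case (Cons s ss)
  have "sconss ss (map (tsub \<sigma>) (map (tsub (shift [s])) (bvars ss))) (scomp (shift (s # ss)) \<sigma>)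
      = scomp (shift [s]) \<sigma>"
    using Cons by (subst map_tsub_tsub[of _ ss]) (simp_all add: shift_Cons[of s ss] scomp_assoc)
  moreover have "scons s (\<sigma> s 0) (scomp (shift [s]) \<sigma>) = \<sigma>"
    using Cons.prems by (intro ext) (auto simp: scons_def scomp_def shift_def split: nat.split)
  ultimately show ?case using Cons.prems by simp
qed simp

lemma ups_var [simp]: "ups ss var = var"
  using sconss_eta[of var ss] by (simp add: ups_sconss map_tsub_var[of _ ss])

lemma ups_sconss_comp:
  assumes "well_sorted ts ss" "is_sbst \<sigma>" "is_sbst \<tau>"
  shows "scomp (ups ss \<sigma>) (sconss ss ts \<tau>) = sconss ss ts (scomp \<sigma> \<tau>)"
  using assms by (simp add: ups_sconss scomp_sconss bvars_sconss scomp_assoc shift_sconss)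

lemma ups_ups:
  assumes "is_sbst \<sigma>" "is_sbst \<tau>"
  shows "scomp (ups ss \<sigma>) (ups ss \<tau>) = ups ss (scomp \<sigma> \<tau>)"
  using assms ups_sconss_comp[of "bvars ss" ss \<sigma> "scomp \<tau> (shift ss)"]
  by (simp add: ups_sconss scomp_assoc)

lemma ups_inst:
  assumes "well_sorted ts ss" "is_sbst \<sigma>"
  shows "scomp (ups ss \<sigma>) (inst ss ts) = sconss ss ts \<sigma>"
  using ups_sconss_comp[OF assms, of var] assms by (simp add: inst_sconss)

lemma inst_comp:
  assumes "well_sorted ts ss" "is_sbst \<sigma>"
  shows "scomp (inst ss ts) \<sigma> = sconss ss (map (tsub \<sigma>) ts) \<sigma>"
  using assms by (simp add: inst_sconss scomp_sconss well_sorted_length)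

lemma shift_ups: "is_sbst \<sigma> \<Longrightarrow> scomp (shift ss) (ups ss \<sigma>) = scomp \<sigma> (shift ss)"
  by (simp add: ups_sconss shift_sconss)

section \<open>Term substitution and negation on formulas\<close>

lemma wf_fsub [simp]: "wf \<Pi> P \<Longrightarrow> is_sbst \<sigma> \<Longrightarrow> wf \<Pi> (fsub \<sigma> P)"
  by (induction P arbitrary: \<Pi> \<sigma>) (auto simp: is_sbst_Tm simp del: ups.simps)

lemma fsub_fsub:
  "wf \<Pi> P \<Longrightarrow> is_sbst \<sigma> \<Longrightarrow> is_sbst \<tau> \<Longrightarrow> fsub \<tau> (fsub \<sigma> P) = fsub (scomp \<sigma> \<tau>) P"
  by (induction P arbitrary: \<Pi> \<sigma> \<tau>)
    (auto simp: tsub_scomp ups_ups map_tsub_tsub simp del: ups.simps map_map)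

lemma fsub_var: "wf \<Pi> P \<Longrightarrow> fsub var P = P"
  by (induction P arbitrary: \<Pi>) (auto simp: tsub_id map_tsub_var simp del: ups.simps)

lemma neg_neg [simp]: "neg (neg P) = P"
  by (induction P) auto

lemma wf_neg [simp]: "wf \<Pi> (neg P) = wf \<Pi> P"
  by (induction P arbitrary: \<Pi>) auto

lemma neg_fsub: "neg (fsub \<sigma> P) = fsub \<sigma> (neg P)"
  by (induction P arbitrary: \<sigma>) auto

lemma async_fsub [simp]: "async (fsub \<sigma> P) = async P"
  by (cases P) auto

lemma async_neg: "formula P \<Longrightarrow> async (neg P) \<longleftrightarrow> \<not> async P"
  by (cases P) auto

lemma size_fsub [simp]: "size (fsub \<sigma> P) = size P"
  by (induction P arbitrary: \<sigma>) auto

lemma wf_append: "wf \<Pi> P \<Longrightarrow> wf (\<Pi> @ \<Pi>') P"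
proof (induction P arbitrary: \<Pi>)
  case (Mu ss B ts)
  then have "wf ((ss # \<Pi>) @ \<Pi>') B" by (auto simp del: append_Cons)
  with Mu show ?case by simp
next
  case (Nu ss B ts)
  then have "wf ((ss # \<Pi>) @ \<Pi>') B" by (auto simp del: append_Cons)
  with Nu show ?case by simp
qed (auto simp: nth_append)

lemma wf_formula: "formula P \<Longrightarrow> wf \<Pi> P"
  using wf_append[of "[]" P \<Pi>] by simp

section \<open>Replacement of predicate variables\<close>

lemma wf_plift [simp]: "wf \<Pi> S \<Longrightarrow> is_sbst \<sigma> \<Longrightarrow> wf \<Pi> (plift ss \<sigma> S)"
  by (simp add: plift_def)

lemma wf_psub:
  "wf (\<Pi>1 @ ss # \<Pi>2) P \<Longrightarrow> k = length \<Pi>1 \<Longrightarrow> formula S \<Longrightarrow> wf (\<Pi>1 @ \<Pi>2) (psub ss k S P)"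
proof (induction P arbitrary: \<Pi>1 k S)
  case (PVar i ts)
  then show ?case by (auto simp: nth_append wf_formula nth_Cons' Suc_diff_Suc)
next
  case (Mu ss' B ts)
  then show ?case using Mu.IH[of "ss' # \<Pi>1"] by simp
next
  case (Nu ss' B ts)
  then show ?case using Nu.IH[of "ss' # \<Pi>1"] by simp
qed auto

lemma plift_plift:
  "wf \<Pi> S \<Longrightarrow> is_sbst \<sigma> \<Longrightarrow> is_sbst \<tau> \<Longrightarrow> plift ss \<tau> (plift ss \<sigma> S) = plift ss (scomp \<sigma> \<tau>) S"
  by (simp add: plift_def fsub_fsub ups_ups)

lemma plift_ups_shift:
  "wf \<Pi> S \<Longrightarrow> is_sbst \<sigma> \<Longrightarrow>
    plift ss (ups ss' \<sigma>) (plift ss (shift ss') S) = plift ss (shift ss') (plift ss \<sigma> S)"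
  by (simp add: plift_plift shift_ups del: ups.simps)

lemma fsub_psub:
  "wf (\<Pi>1 @ ss # \<Pi>2) P \<Longrightarrow> k = length \<Pi>1 \<Longrightarrow> formula S \<Longrightarrow> is_sbst \<sigma> \<Longrightarrow>
    fsub \<sigma> (psub ss k S P) = psub ss k (plift ss \<sigma> S) (fsub \<sigma> P)"
proof (induction P arbitrary: \<Pi>1 k S \<sigma>)
  case (PVar i ts)
  then show ?case
    by (auto simp: nth_append fsub_fsub plift_def ups_inst inst_comp)
next
  case (Mu ss' B ts)
  then show ?case using Mu.IH[of "ss' # \<Pi>1"] by (simp add: plift_ups_shift)
next
  case (Nu ss' B ts)
  then show ?case using Nu.IH[of "ss' # \<Pi>1"] by (simp add: plift_ups_shift)
next
  case (Ex s P)
  then show ?case by (simp add: plift_ups_shift del: ups.simps)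
next
  case (All s P)
  then show ?case by (simp add: plift_ups_shift del: ups.simps)
qed auto

declare ups.simps [simp del] inst.simps [simp del] multiset.map_comp [simp del]

lemma well_sorted_single [simp]: "well_sorted [t] [s] \<longleftrightarrow> t \<in> Tm s"
  by (simp add: well_sorted_def)

lemma fsub_inst:
  "wf \<Pi> P \<Longrightarrow> well_sorted ts ss \<Longrightarrow> is_sbst \<sigma> \<Longrightarrow>
    fsub \<sigma> (fsub (inst ss ts) P) = fsub (inst ss (map (tsub \<sigma>) ts)) (fsub (ups ss \<sigma>) P)"
  by (simp add: fsub_fsub ups_inst inst_comp)

lemma psub_closed: "wf \<Pi> P \<Longrightarrow> length \<Pi> \<le> k \<Longrightarrow> psub ss k S P = P"
proof (induction P arbitrary: \<Pi> k S)
  case (Mu ss' B ts)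
  then show ?case using Mu.IH[of "ss' # \<Pi>"] by simp
next
  case (Nu ss' B ts)
  then show ?case using Nu.IH[of "ss' # \<Pi>"] by simp
qed auto

text \<open>Replacing \<open>Suc j\<close> first leaves \<open>k\<close> in place, while replacing
  \<open>k\<close> first renumbers \<open>Suc j\<close> to \<open>j\<close>. Neither predicate is
  affected by the other replacement, since both are without free predicate variables.\<close>

lemma psub_psub:
  "wf (\<Pi>1 @ ss # \<Pi>2 @ ss' # \<Pi>3) P \<Longrightarrow> k = length \<Pi>1 \<Longrightarrow> j = length \<Pi>1 + length \<Pi>2 \<Longrightarrow>
    formula S \<Longrightarrow> formula T \<Longrightarrow>
    psub ss k S (psub ss' (Suc j) T P) = psub ss' j T (psub ss k S P)"
proof (induction P arbitrary: \<Pi>1 k j S T)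
  case (PVar i ts)
  then show ?case
    by (auto simp: nth_append nth_Cons' psub_closed[of "[]"])
next
  case (Mu ss'' B ts)
  then show ?case using Mu.IH[of "ss'' # \<Pi>1"] by simp
next
  case (Nu ss'' B ts)
  then show ?case using Nu.IH[of "ss'' # \<Pi>1"] by simp
qed auto

text \<open>Since \<^const>\<open>psub\<close> renumbers, always replacing \<open>k\<close> replaces \<open>k, k + 1, \<dots>\<close> by the predicates of the list.\<close>

primrec psubs :: "nat \<Rightarrow> ('s list \<times> ('s, 't, 'a) form) list \<Rightarrow> ('s, 't, 'a) form \<Rightarrow> ('s, 't, 'a) form" where
  "psubs k [] P = P"
| "psubs k (x # xs) P = psubs k xs (psub (fst x) k (snd x) P)"

definition plifts :: "('s, 't) sbst \<Rightarrow> ('s list \<times> ('s, 't, 'a) form) list \<Rightarrow>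
    ('s list \<times> ('s, 't, 'a) form) list" where
  "plifts \<sigma> = map (\<lambda>(ss, S). (ss, plift ss \<sigma> S))"

abbreviation preds :: "('s list \<times> ('s, 't, 'a) form) list \<Rightarrow> bool" where
  "preds \<equiv> list_all (\<lambda>x. formula (snd x))"

lemma plifts_simps [simp]:
  "plifts \<sigma> [] = []"
  "plifts \<sigma> (x # xs) = (fst x, plift (fst x) \<sigma> (snd x)) # plifts \<sigma> xs"
  "map fst (plifts \<sigma> xs) = map fst xs"
  by (auto simp: plifts_def split: prod.splits)

lemma preds_plifts [simp]: "preds xs \<Longrightarrow> is_sbst \<sigma> \<Longrightarrow> preds (plifts \<sigma> xs)"
  by (auto simp: plifts_def list_all_iff)

lemma psubs_simps [simp]:
  "psubs k xs (Tensor P Q) = Tensor (psubs k xs P) (psubs k xs Q)"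
  "psubs k xs (Par P Q) = Par (psubs k xs P) (psubs k xs Q)"
  "psubs k xs (Plus P Q) = Plus (psubs k xs P) (psubs k xs Q)"
  "psubs k xs (With P Q) = With (psubs k xs P) (psubs k xs Q)"
  "psubs k xs One = One"
  "psubs k xs Bot = Bot"
  "psubs k xs Zero = Zero"
  "psubs k xs Top = Top"
  "psubs k xs (Ex s P) = Ex s (psubs k (plifts (shift [s]) xs) P)"
  "psubs k xs (All s P) = All s (psubs k (plifts (shift [s]) xs) P)"
  "psubs k xs (Eq s t u) = Eq s t u"
  "psubs k xs (Neq s t u) = Neq s t u"
  "psubs k xs (Atom a ts) = Atom a ts"
  "psubs k xs (NAtom a ts) = NAtom a ts"
  "psubs k xs (Mu ss B ts) = Mu ss (psubs (Suc k) (plifts (shift ss) xs) B) ts"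
  "psubs k xs (Nu ss B ts) = Nu ss (psubs (Suc k) (plifts (shift ss) xs) B) ts"
  by (induction xs arbitrary: P Q B; simp)+

lemma psubs_closed: "formula P \<Longrightarrow> psubs k xs P = P"
  by (induction xs) (simp_all add: psub_closed[of "[]"])

lemma psubs_PVar:
  "i < length xs \<Longrightarrow> preds xs \<Longrightarrow> well_sorted ts (fst (xs ! i)) \<Longrightarrow>
    psubs 0 xs (PVar i ts) = fsub (inst (fst (xs ! i)) ts) (snd (xs ! i))"
proof (induction xs arbitrary: i)
  case (Cons x xs)
  then show ?case by (cases i) (simp_all add: psubs_closed)
qed simp

lemma wf_psubs:
  "wf (\<Pi> @ map fst xs) P \<Longrightarrow> k = length \<Pi> \<Longrightarrow> preds xs \<Longrightarrow> wf \<Pi> (psubs k xs P)"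
  by (induction xs arbitrary: P) (simp_all add: wf_psub)

lemma psub_psubs:
  "wf (ss # map fst xs) P \<Longrightarrow> preds xs \<Longrightarrow> formula S \<Longrightarrow>
    psub ss 0 S (psubs (Suc 0) xs P) = psubs 0 ((ss, S) # xs) P"
proof (induction xs arbitrary: P)
  case (Cons x xs)
  have "wf ([ss] @ map fst xs) (psub (fst x) (Suc 0) (snd x) P)"
    using Cons.prems by (intro wf_psub) auto
  with Cons show ?case
    using psub_psub[of "[]" ss "[]" "fst x" "map fst xs" P 0 0 S "snd x"] by simp
qed simp

section \<open>Unfolding of least fixed points\<close>

definition mupred :: "'s list \<Rightarrow> ('s, 't, 'a) form \<Rightarrow> ('s, 't, 'a) form" where
  "mupred ss B = Mu ss (plift ss (shift ss) B) (bvars ss)"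

lemma unfold_mu_alt: "unfold_mu ss B ts = fsub (inst ss ts) (papp ss B (mupred ss B))"
  by (simp add: unfold_mu_def mupred_def)

lemma wf_mupred [simp]: "wf [ss] B \<Longrightarrow> formula (mupred ss B)"
  by (simp add: mupred_def)

lemma wf_papp [simp]: "wf [ss] B \<Longrightarrow> formula S \<Longrightarrow> formula (papp ss B S)"
  using wf_psub[of "[]" ss "[]" B 0 "plift ss (shift ss) S"] by (simp add: papp_def)

lemma wf_unfold_mu [simp]: "wf [ss] B \<Longrightarrow> well_sorted ts ss \<Longrightarrow> formula (unfold_mu ss B ts)"
  by (simp add: unfold_mu_alt)

lemma mupred_sconss:
  "wf [ss] B \<Longrightarrow> is_sbst \<tau> \<Longrightarrow> well_sorted ts ss \<Longrightarrow>
    fsub (sconss ss ts \<tau>) (mupred ss B) = Mu ss (plift ss \<tau> B) ts"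
  using plift_plift[of "[ss]" B "shift ss" "sconss ss ts \<tau>" ss]
  by (simp add: mupred_def bvars_sconss shift_sconss) (simp add: plift_def)

lemma plift_mupred: "wf [ss] B \<Longrightarrow> is_sbst \<tau> \<Longrightarrow> plift ss \<tau> (mupred ss B) = mupred ss (plift ss \<tau> B)"
  by (simp add: plift_def[of _ _ "mupred ss B"] ups_sconss mupred_sconss)
    (simp add: mupred_def plift_plift)

lemma plift_papp:
  "wf [ss] B \<Longrightarrow> formula S \<Longrightarrow> is_sbst \<tau> \<Longrightarrow>
    plift ss \<tau> (papp ss B S) = papp ss (plift ss \<tau> B) (plift ss \<tau> S)"
  using fsub_psub[of "[]" ss "[]" B 0 "plift ss (shift ss) S" "ups ss \<tau>"]
  by (simp add: papp_def plift_ups_shift) (simp add: plift_def)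

lemma unfold_mu_sconss:
  "wf [ss] B \<Longrightarrow> is_sbst \<tau> \<Longrightarrow> well_sorted ts ss \<Longrightarrow>
    fsub (sconss ss ts \<tau>) (papp ss B (mupred ss B)) = unfold_mu ss (plift ss \<tau> B) ts"
  by (simp add: unfold_mu_alt plift_mupred[symmetric] plift_papp[symmetric])
    (simp add: plift_def fsub_fsub[of "[]"] ups_inst)

lemma fsub_unfold_mu:
  "wf [ss] B \<Longrightarrow> is_sbst \<sigma> \<Longrightarrow> well_sorted ts ss \<Longrightarrow>
    fsub \<sigma> (unfold_mu ss B ts) = unfold_mu ss (fsub (ups ss \<sigma>) B) (map (tsub \<sigma>) ts)"
  by (simp add: unfold_mu_alt[of ss B] fsub_fsub[of "[]"] inst_comp unfold_mu_sconss plift_def)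

text \<open>At the generic arguments the shift of the operator and the instantiation cancel, because
  extending the shift by the bound variables is the identity substitution.\<close>

lemma unfold_mu_bvars:
  assumes "wf [ss] B"
  shows "unfold_mu ss (plift ss (shift ss) B) (bvars ss) = papp ss B (mupred ss B)"
proof -
  have "sconss ss (bvars ss) (shift ss) = var"
    using ups_sconss[of var ss] by simp
  then show ?thesis
    using unfold_mu_sconss[OF assms, of "shift ss" "bvars ss"] assms by (simp add: fsub_var[of "[]"])
qed

section \<open>Focused derivations under substitution\<close>

definition wfi :: "('s, 't, 'a) item \<Rightarrow> bool" where
  "wfi i = (case i of Plain P \<Rightarrow> formula P | Frozen P \<Rightarrow> formula P)"

abbreviation wfc :: "('s, 't, 'a) item multiset \<Rightarrow> bool" where
  "wfc \<Gamma> \<equiv> \<forall>i\<in>#\<Gamma>. wfi i"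

abbreviation wfs :: "('s, 't, 'a) form multiset \<Rightarrow> bool" where
  "wfs \<Delta> \<equiv> \<forall>P\<in>#\<Delta>. formula P"

abbreviation csub :: "('s, 't) sbst \<Rightarrow> ('s, 't, 'a) item multiset \<Rightarrow> ('s, 't, 'a) item multiset" where
  "csub \<sigma> \<Gamma> \<equiv> image_mset (isub \<sigma>) \<Gamma>"

abbreviation msub :: "('s, 't) sbst \<Rightarrow> ('s, 't, 'a) form multiset \<Rightarrow> ('s, 't, 'a) form multiset" where
  "msub \<sigma> \<Delta> \<equiv> image_mset (fsub \<sigma>) \<Delta>"

lemma wfi_simps [simp]: "wfi (Plain P) = formula P" "wfi (Frozen P) = formula P"
  by (simp_all add: wfi_def)

lemma wfi_isub [simp]: "wfi i \<Longrightarrow> is_sbst \<sigma> \<Longrightarrow> wfi (isub \<sigma> i)"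
  by (cases i) simp_all

lemma csub_csub:
  "wfc \<Gamma> \<Longrightarrow> is_sbst \<sigma> \<Longrightarrow> is_sbst \<tau> \<Longrightarrow> csub \<tau> (csub \<sigma> \<Gamma>) = csub (scomp \<sigma> \<tau>) \<Gamma>"
proof (induction \<Gamma>)
  case (add i \<Gamma>)
  then show ?case by (cases i) (simp_all add: fsub_fsub[of "[]"])
qed simp

lemma msub_msub:
  "wfs \<Delta> \<Longrightarrow> is_sbst \<sigma> \<Longrightarrow> is_sbst \<tau> \<Longrightarrow> msub \<tau> (msub \<sigma> \<Delta>) = msub (scomp \<sigma> \<tau>) \<Delta>"
  by (induction \<Delta>) (simp_all add: fsub_fsub[of "[]"])

lemma csub_var [simp]: "wfc \<Gamma> \<Longrightarrow> csub var \<Gamma> = \<Gamma>"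
proof (induction \<Gamma>)
  case (add i \<Gamma>)
  then show ?case by (cases i) (simp_all add: fsub_var[of "[]"])
qed simp

lemma msub_var [simp]: "wfs \<Delta> \<Longrightarrow> msub var \<Delta> = \<Delta>"
  by (induction \<Delta>) (simp_all add: fsub_var[of "[]"])

text \<open>Every unifier factors through itself with \<open>var\<close> as second factor. The rule
  for \<noteq> thereby applies to any two terms without a theory of unification, and its premises
  become all unifying instances, which matches the quantification over substitutions below.\<close>

lemma csu_unifiers: "csu t u {\<theta>. unifier t u \<theta>}"
  unfolding csu_def
proof (intro conjI allI impI ballI)
  fix \<sigma> assume \<sigma>: "unifier t u \<sigma>"
  then have "\<sigma> = scomp \<sigma> var" by (simp add: unifier_def)
  then have "\<sigma> = (\<lambda>s j. tsub var (\<sigma> s j))" by (simp add: scomp_def)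
  with \<sigma> show "\<exists>\<theta>\<in>{\<theta>. unifier t u \<theta>}. \<exists>\<delta>. is_sbst \<delta> \<and> \<sigma> = (\<lambda>s j. tsub \<delta> (\<theta> s j))"
    using is_sbst_var by blast
qed simp

lemma csu_factor:
  assumes "csu t u U" "unifier t u \<sigma>"
  obtains \<theta> \<delta> where "\<theta> \<in> U" "is_sbst \<theta>" "is_sbst \<delta>" "\<sigma> = scomp \<theta> \<delta>"
  using assms unfolding csu_def scomp_def unifier_def by metis

lemma foc_sub:
  "foc_up \<Gamma> \<Delta> \<Longrightarrow> wfc \<Gamma> \<Longrightarrow> wfs \<Delta> \<Longrightarrow> is_sbst \<sigma> \<Longrightarrow> foc_up (csub \<sigma> \<Gamma>) (msub \<sigma> \<Delta>)"
  "foc_dn \<Gamma> P \<Longrightarrow> wfc \<Gamma> \<Longrightarrow> formula P \<Longrightarrow> is_sbst \<sigma> \<Longrightarrow> foc_dn (csub \<sigma> \<Gamma>) (fsub \<sigma> P)"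
proof (induction arbitrary: \<sigma> and \<sigma> rule: foc_up_foc_dn.inducts)
  case (all_up s \<Gamma> P \<Delta>)
  have "foc_up (csub (ups [s] \<sigma>) (csub (shift [s]) \<Gamma>))
      (msub (ups [s] \<sigma>) (add_mset P (msub (shift [s]) \<Delta>)))"
    using all_up.prems by (intro all_up.IH(2)) auto
  moreover have "csub (ups [s] \<sigma>) (csub (shift [s]) \<Gamma>) = csub (shift [s]) (csub \<sigma> \<Gamma>)"
    using all_up.prems by (simp add: csub_csub shift_ups)
  moreover have "msub (ups [s] \<sigma>) (msub (shift [s]) \<Delta>) = msub (shift [s]) (msub \<sigma> \<Delta>)"
    using all_up.prems by (simp add: msub_msub shift_ups)
  ultimately show ?case by (simp add: foc_up_foc_dn.all_up)
next
  case (neq_up t u U \<Gamma> \<Delta> s)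
  \<comment> \<open>All unifiers of the instantiated terms are used. Each one, composed with
    \<sigma>, unifies the original terms, so it factors through a member of \<open>U\<close>, whose
    premise is instantiated further.\<close>
  have "foc_up (csub \<theta> (csub \<sigma> \<Gamma>)) (msub \<theta> (msub \<sigma> \<Delta>))"
    if \<theta>: "unifier (tsub \<sigma> t) (tsub \<sigma> u) \<theta>" for \<theta>
  proof -
    have "unifier t u (scomp \<sigma> \<theta>)"
      using \<theta> neq_up.prems tsub_scomp[of \<sigma> \<theta> t s] tsub_scomp[of \<sigma> \<theta> u s]
      by (auto simp: unifier_def)
    then obtain \<theta>' \<delta> where *: "\<theta>' \<in> U" "is_sbst \<theta>'" "is_sbst \<delta>" "scomp \<sigma> \<theta> = scomp \<theta>' \<delta>"
      using csu_factor[OF neq_up.IH(1)] by metis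
    then have "foc_up (csub \<delta> (csub \<theta>' \<Gamma>)) (msub \<delta> (msub \<theta>' \<Delta>))"
      using neq_up.prems by (intro neq_up.IH(3)) auto
    with * \<theta> neq_up.prems show ?thesis
      by (simp add: csub_csub msub_msub unifier_def)
  qed
  then show ?case
    using foc_up_foc_dn.neq_up[OF csu_unifiers, of "tsub \<sigma> t" "tsub \<sigma> u"] by simp
next
  case (mu_unfold \<Gamma> ss B ts \<Delta>)
  then show ?case by (simp add: fsub_unfold_mu foc_up_foc_dn.mu_unfold)
next
  case (ex_dn t s \<Gamma> P)
  then have "foc_dn (csub \<sigma> \<Gamma>) (fsub (inst [s] [tsub \<sigma> t]) (fsub (ups [s] \<sigma>) P))"
    using fsub_inst[of "[]" P "[t]" "[s]" \<sigma>] ex_dn.IH(3)[of \<sigma>] by simp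
  with ex_dn show ?case by (auto intro: foc_up_foc_dn.ex_dn is_sbst_Tm)
next
  case (nu_coind S \<Gamma> ss ts B)
  have "foc_dn (csub \<sigma> \<Gamma>) (fsub (inst ss (map (tsub \<sigma>) ts)) (plift ss \<sigma> S))"
    using nu_coind.IH(1) nu_coind.IH(3)[of \<sigma>] nu_coind.prems fsub_inst[of "[]" S ts ss \<sigma>]
    by (simp add: plift_def)
  \<comment> \<open>The coinvariant may contain ambient variables, which are instantiated too; its
    own variables stay generic, hence \<open>ups ss \<sigma>\<close>.\<close>
  moreover have "foc_up {#} {#papp ss (fsub (ups ss \<sigma>) B) (plift ss \<sigma> S), neg (plift ss \<sigma> S)#}"
    using nu_coind.IH(5)[of "ups ss \<sigma>"] nu_coind.prems nu_coind.IH(1) plift_papp[of ss B S \<sigma>]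
    by (simp add: plift_def neg_fsub)
  ultimately show ?case
    using nu_coind by (auto intro!: foc_up_foc_dn.nu_coind[where S = "plift ss \<sigma> S"])
next
  case (nu_ax ss B ts)
  then show ?case by (simp add: neg_fsub[symmetric] foc_up_foc_dn.nu_ax)
next
  case (focus P \<Gamma>)
  then show ?case by (simp add: foc_up_foc_dn.focus)
next
  case (release P \<Gamma>)
  then show ?case by (simp add: foc_up_foc_dn.release)
qed (auto intro: foc_up_foc_dn.intros)

section \<open>Replacing a stored formula\<close>

text \<open>Closed under substitutions because the stored \<open>A\<close> may be consumed above a
  \<forall> or \<noteq> inference, where both \<open>A\<close> and \<open>K\<close> have been
  instantiated.\<close>

definition cont :: "('s, 't, 'a) form \<Rightarrow> ('s, 't, 'a) item multiset \<Rightarrow> bool" where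
  "cont A K \<longleftrightarrow> (\<forall>\<theta> \<Xi>. is_sbst \<theta> \<longrightarrow> wfc \<Xi> \<longrightarrow> foc_dn \<Xi> (fsub \<theta> A) \<longrightarrow> foc_up (csub \<theta> K + \<Xi>) {#})"

lemma contD:
  assumes "cont A K" "formula A" "wfc K" "wfc \<Xi>" "foc_dn \<Xi> A"
  shows "foc_up (K + \<Xi>) {#}"
  using assms(1)[unfolded cont_def, rule_format, of var \<Xi>] assms by (simp add: fsub_var[of "[]"])

lemma cont_sub:
  assumes "cont A K" "formula A" "wfc K" "is_sbst \<sigma>"
  shows "cont (fsub \<sigma> A) (csub \<sigma> K)"
  unfolding cont_def
proof (intro allI impI)
  fix \<theta> \<Xi> assume "is_sbst \<theta>" "wfc \<Xi>" "foc_dn \<Xi> (fsub \<theta> (fsub \<sigma> A))"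
  then show "foc_up (csub \<theta> (csub \<sigma> K) + \<Xi>) {#}"
    using assms(1)[unfolded cont_def, rule_format, of "scomp \<sigma> \<theta>" \<Xi>] assms
    by (simp add: fsub_fsub[of "[]"] csub_csub)
qed

text \<open>The stored \<open>A\<close> moves upwards, changed only by substitutions, and follows
  one premise of \<open>tensor_dn\<close>. Unless the branch closes by \<open>top_up\<close>, it
  must finally be focused on, and the context of that focus is the \<Xi> of \<open>cont\<close>. The
  other rules without premises cannot contain it.\<close>

lemma foc_replace:
  "foc_up \<Gamma>0 \<Delta> \<Longrightarrow> \<Gamma>0 = add_mset (Plain A) \<Gamma> \<Longrightarrow> wfc \<Gamma>0 \<Longrightarrow> wfs \<Delta> \<Longrightarrow> wfc K \<Longrightarrow> cont A K \<Longrightarrow>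
    foc_up (K + \<Gamma>) \<Delta>"
  "foc_dn \<Gamma>0 P \<Longrightarrow> \<Gamma>0 = add_mset (Plain A) \<Gamma> \<Longrightarrow> wfc \<Gamma>0 \<Longrightarrow> formula P \<Longrightarrow> wfc K \<Longrightarrow> cont A K \<Longrightarrow>
    foc_dn (K + \<Gamma>) P"
proof (induction arbitrary: A K \<Gamma> and A K \<Gamma> rule: foc_up_foc_dn.inducts)
  case (par_up \<Gamma>' P Q \<Delta>)
  then show ?case by (auto intro!: foc_up_foc_dn.par_up)
next
  case (bot_up \<Gamma> \<Delta>)
  then show ?case by (auto intro!: foc_up_foc_dn.bot_up)
next
  case (with_up \<Gamma> P \<Delta> Q)
  then show ?case by (auto intro!: foc_up_foc_dn.with_up)
next
  case (top_up \<Gamma> \<Delta>)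
  then show ?case by (auto intro!: foc_up_foc_dn.top_up)
next
  case (all_up s \<Gamma>' P \<Delta>)
  have "foc_up (csub (shift [s]) K + csub (shift [s]) \<Gamma>) (add_mset P (msub (shift [s]) \<Delta>))"
    using all_up.prems by (intro all_up.IH(2)[where A = "fsub (shift [s]) A"]) (auto intro: cont_sub)
  then show ?case using all_up.prems by (auto intro!: foc_up_foc_dn.all_up)
next
  case (neq_up t u U \<Gamma>' \<Delta> s)
  have "foc_up (csub \<theta> (K + \<Gamma>)) (msub \<theta> \<Delta>)" if "\<theta> \<in> U" for \<theta>
  proof -
    have \<theta>: "is_sbst \<theta>" using that neq_up.IH(1) by (simp add: csu_def unifier_def)
    have "foc_up (csub \<theta> K + csub \<theta> \<Gamma>) (msub \<theta> \<Delta>)"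
      using neq_up.prems that \<theta> by (intro neq_up.IH(3)[where A = "fsub \<theta> A"]) (auto intro: cont_sub)
    then show ?thesis by simp
  qed
  with neq_up.IH(1) show ?case by (auto intro!: foc_up_foc_dn.neq_up)
next
  case (natom_freeze a ts \<Gamma>' \<Delta>)
  then show ?case
    using natom_freeze.IH(2)[of A "add_mset (Frozen (NAtom a ts)) \<Gamma>" K]
    by (auto simp: add_mset_commute intro: foc_up_foc_dn.natom_freeze)
next
  case (mu_unfold \<Gamma>' ss B ts \<Delta>)
  then show ?case by (auto intro!: foc_up_foc_dn.mu_unfold)
next
  case (mu_freeze ss B ts \<Gamma>' \<Delta>)
  then show ?case
    using mu_freeze.IH(2)[of A "add_mset (Frozen (Mu ss B ts)) \<Gamma>" K]
    by (auto simp: add_mset_commute intro: foc_up_foc_dn.mu_freeze)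
next
  case (tensor_dn \<Gamma>1 P \<Gamma>2 Q)
  have "Plain A \<in># \<Gamma>1 + \<Gamma>2" using tensor_dn.prems by simp
  then consider \<Gamma>' where "\<Gamma>1 = add_mset (Plain A) \<Gamma>'" | \<Gamma>' where "\<Gamma>2 = add_mset (Plain A) \<Gamma>'"
    by (auto dest: multi_member_split)
  then show ?case
  proof cases
    case 1
    then have "foc_dn (K + \<Gamma>') P" using tensor_dn.prems by (intro tensor_dn.IH(2)) auto
    from foc_up_foc_dn.tensor_dn[OF this tensor_dn.IH(3)] show ?thesis
      using 1 tensor_dn.prems(1) by (simp add: ac_simps)
  next
    case 2
    then have "foc_dn (K + \<Gamma>') Q" using tensor_dn.prems by (intro tensor_dn.IH(4)) auto
    from foc_up_foc_dn.tensor_dn[OF tensor_dn.IH(1) this] show ?thesis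
      using 2 tensor_dn.prems(1) by (simp add: ac_simps)
  qed
next
  case (plus1_dn \<Gamma>' P Q)
  then show ?case by (auto intro!: foc_up_foc_dn.plus1_dn)
next
  case (plus2_dn \<Gamma>' Q P)
  then show ?case by (auto intro!: foc_up_foc_dn.plus2_dn)
next
  case (ex_dn t s \<Gamma>' P)
  then show ?case by (auto intro!: foc_up_foc_dn.ex_dn[of t])
next
  case (nu_coind S \<Gamma>' ss ts B)
  then have "foc_dn (K + \<Gamma>) (fsub (inst ss ts) S)" by auto
  \<comment> \<open>The invariance premise has an empty context and is reused unchanged.\<close>
  with nu_coind.IH(1,4) show ?case by (auto intro: foc_up_foc_dn.nu_coind)
next
  case (store P \<Gamma>' \<Delta>)
  then show ?case
    using store.IH(2)[of A "add_mset (Plain P) \<Gamma>" K]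
    by (auto simp: add_mset_commute intro: foc_up_foc_dn.store)
next
  case (focus P \<Gamma>')
  show ?case
  proof (cases "A = P")
    case True
    with focus show ?thesis by (auto intro: contD)
  next
    case False
    with focus.prems obtain \<Gamma>'' where "\<Gamma>' = add_mset (Plain A) \<Gamma>''" "\<Gamma> = add_mset (Plain P) \<Gamma>''"
      by (auto simp: add_eq_conv_ex)
    with focus show ?thesis
      using focus.IH(2)[of A \<Gamma>'' K] by (auto intro: foc_up_foc_dn.focus)
  qed
next
  case (release P \<Gamma>')
  then show ?case by (auto intro!: foc_up_foc_dn.release)
qed auto

lemma foc_dn_up:
  assumes "foc_dn \<Gamma> P"
  shows "foc_up \<Gamma> {#P#}"
proof (cases "async P")
  case True
  with assms show ?thesis by (cases rule: foc_dn.cases) auto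
next
  case False
  with assms show ?thesis by (auto intro: store focus)
qed

section \<open>Identity expansion and functoriality\<close>

text \<open>
  \<open>lk X Y\<close> says that, to prove \<open>X\<close> asynchronously, it suffices to consider the contexts that prove
  \<open>Y\<close> under focus. The quantification over \<open>\<theta>\<close> is needed for \<open>\<forall>\<close> and \<open>\<noteq>\<close>, whose premises live
  under a substitution.
\<close>

definition lk :: "('s, 't, 'a) form \<Rightarrow> ('s, 't, 'a) form \<Rightarrow> bool" where
  "lk X Y \<longleftrightarrow> (\<forall>\<sigma> \<Gamma> \<Delta>. is_sbst \<sigma> \<longrightarrow> wfc \<Gamma> \<longrightarrow> wfs \<Delta> \<longrightarrow>
     (\<forall>\<theta> \<Xi>. is_sbst \<theta> \<longrightarrow> wfc \<Xi> \<longrightarrow> foc_dn \<Xi> (fsub (scomp \<sigma> \<theta>) Y) \<longrightarrow>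
        foc_up (csub \<theta> \<Gamma> + \<Xi>) (msub \<theta> \<Delta>)) \<longrightarrow>
     foc_up \<Gamma> (add_mset (fsub \<sigma> X) \<Delta>))"

lemma lkI:
  assumes "\<And>\<sigma> \<Gamma> \<Delta>. is_sbst \<sigma> \<Longrightarrow> wfc \<Gamma> \<Longrightarrow> wfs \<Delta> \<Longrightarrow>
     (\<And>\<theta> \<Xi>. is_sbst \<theta> \<Longrightarrow> wfc \<Xi> \<Longrightarrow> foc_dn \<Xi> (fsub (scomp \<sigma> \<theta>) Y) \<Longrightarrow>
        foc_up (csub \<theta> \<Gamma> + \<Xi>) (msub \<theta> \<Delta>)) \<Longrightarrow>
     foc_up \<Gamma> (add_mset (fsub \<sigma> X) \<Delta>)"
  shows "lk X Y"
  using assms unfolding lk_def by blast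

lemma lkD:
  assumes "lk X Y" "is_sbst \<sigma>" "wfc \<Gamma>" "wfs \<Delta>"
    and "\<And>\<theta> \<Xi>. is_sbst \<theta> \<Longrightarrow> wfc \<Xi> \<Longrightarrow> foc_dn \<Xi> (fsub (scomp \<sigma> \<theta>) Y) \<Longrightarrow>
        foc_up (csub \<theta> \<Gamma> + \<Xi>) (msub \<theta> \<Delta>)"
  shows "foc_up \<Gamma> (add_mset (fsub \<sigma> X) \<Delta>)"
  using assms unfolding lk_def by blast

lemma lk_fsub:
  assumes "lk X Y" "formula X" "formula Y" "is_sbst \<tau>"
  shows "lk (fsub \<tau> X) (fsub \<tau> Y)"
proof (rule lkI)
  fix \<sigma> \<Gamma> \<Delta>
  assume *: "is_sbst \<sigma>" "wfc \<Gamma>" "wfs \<Delta>"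
    "\<And>\<theta> \<Xi>. is_sbst \<theta> \<Longrightarrow> wfc \<Xi> \<Longrightarrow> foc_dn \<Xi> (fsub (scomp \<sigma> \<theta>) (fsub \<tau> Y)) \<Longrightarrow>
        foc_up (csub \<theta> \<Gamma> + \<Xi>) (msub \<theta> \<Delta>)"
  have "foc_up \<Gamma> (add_mset (fsub (scomp \<tau> \<sigma>) X) \<Delta>)"
    by (rule lkD[OF assms(1)]) (use * assms in \<open>auto simp: fsub_fsub[of "[]"] scomp_assoc\<close>)
  then show "foc_up \<Gamma> (add_mset (fsub \<sigma> (fsub \<tau> X)) \<Delta>)"
    using assms * by (simp add: fsub_fsub[of "[]"])
qed

lemma lk_plift:
  "lk X Y \<Longrightarrow> formula X \<Longrightarrow> formula Y \<Longrightarrow> is_sbst \<tau> \<Longrightarrow> lk (plift ss \<tau> X) (plift ss \<tau> Y)"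
  by (simp add: plift_def lk_fsub)

lemma lk_up:
  assumes "lk X Y" "formula X" "formula Y" "is_sbst \<sigma>"
  shows "foc_up {#} {#fsub \<sigma> X, fsub \<sigma> Y#}"
proof (rule lkD[OF assms(1) assms(4)])
  fix \<theta> \<Xi> assume "is_sbst \<theta>" "wfc \<Xi>" "foc_dn \<Xi> (fsub (scomp \<sigma> \<theta>) Y)"
  then show "foc_up (csub \<theta> {#} + \<Xi>) (msub \<theta> {#fsub \<sigma> Y#})"
    using assms by (simp add: fsub_fsub[of "[]"] foc_dn_up)
qed (use assms in auto)

lemma lk_sync_dn:
  assumes "lk Y X" "\<not> async X" "async Y" "formula X" "is_sbst \<sigma>"
  shows "foc_dn {#Plain (fsub \<sigma> X)#} (fsub \<sigma> Y)"
proof (rule release)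
  show "foc_up {#Plain (fsub \<sigma> X)#} {#fsub \<sigma> Y#}"
  proof (rule lkD[OF assms(1) assms(5)])
    fix \<theta> \<Xi> assume "is_sbst \<theta>" "wfc \<Xi>" "foc_dn \<Xi> (fsub (scomp \<sigma> \<theta>) X)"
    then show "foc_up (csub \<theta> {#Plain (fsub \<sigma> X)#} + \<Xi>) (msub \<theta> {#})"
      using assms by (auto simp: fsub_fsub[of "[]"] intro: focus)
  qed (use assms in auto)
qed (use assms in simp)

text \<open>A synchronous \<open>X\<close> is stored, and the stored \<open>X\<close> alone proves
  \<open>Y\<close> under focus: release \<open>Y\<close> and apply the converse link, closing each
  context by focusing on \<open>X\<close>. For dual connectives only the direction with the
  asynchronous formula on the left needs work.\<close>

lemma lk_sync:
  assumes "\<not> async X" "async Y" "formula X" "formula Y" "lk Y X"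
  shows "lk X Y"
proof (rule lkI)
  fix \<sigma> \<Gamma> \<Delta>
  assume *: "is_sbst \<sigma>" "wfc \<Gamma>" "wfs \<Delta>"
    "\<And>\<theta> \<Xi>. is_sbst \<theta> \<Longrightarrow> wfc \<Xi> \<Longrightarrow> foc_dn \<Xi> (fsub (scomp \<sigma> \<theta>) Y) \<Longrightarrow>
        foc_up (csub \<theta> \<Gamma> + \<Xi>) (msub \<theta> \<Delta>)"
  have "foc_up (csub var \<Gamma> + {#Plain (fsub \<sigma> X)#}) (msub var \<Delta>)"
    by (rule *(4)) (use assms * lk_sync_dn[OF assms(5,1-3)] in auto)
  then show "foc_up \<Gamma> (add_mset (fsub \<sigma> X) \<Delta>)"
    using * assms by (auto intro!: store)
qed

section \<open>Links between dual connectives\<close>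

lemma lk_par:
  assumes "lk A A'" "lk B B'" "formula A" "formula A'" "formula B" "formula B'"
  shows "lk (Par A B) (Tensor A' B')"
proof (rule lkI)
  fix \<sigma> \<Gamma> \<Delta>
  assume *: "is_sbst \<sigma>" "wfc \<Gamma>" "wfs \<Delta>"
    "\<And>\<theta> \<Xi>. is_sbst \<theta> \<Longrightarrow> wfc \<Xi> \<Longrightarrow> foc_dn \<Xi> (fsub (scomp \<sigma> \<theta>) (Tensor A' B')) \<Longrightarrow>
        foc_up (csub \<theta> \<Gamma> + \<Xi>) (msub \<theta> \<Delta>)"
  have "foc_up \<Gamma> (add_mset (fsub \<sigma> A) (add_mset (fsub \<sigma> B) \<Delta>))"
  proof (rule lkD[OF assms(1)])
    fix \<theta> \<Xi> assume 1: "is_sbst \<theta>" "wfc \<Xi>" "foc_dn \<Xi> (fsub (scomp \<sigma> \<theta>) A')"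
    have "foc_up (csub \<theta> \<Gamma> + \<Xi>) (add_mset (fsub (scomp \<sigma> \<theta>) B) (msub \<theta> \<Delta>))"
    proof (rule lkD[OF assms(2)])
      fix \<theta>' \<Xi>' assume 2: "is_sbst \<theta>'" "wfc \<Xi>'" "foc_dn \<Xi>' (fsub (scomp (scomp \<sigma> \<theta>) \<theta>') B')"
      \<comment> \<open>The context found for the left component follows the substitution met while
        the right component is decomposed.\<close>
      have "foc_dn (csub \<theta>' \<Xi>) (fsub \<theta>' (fsub (scomp \<sigma> \<theta>) A'))"
        using 1 2 * assms by (intro foc_sub) auto
      then have "foc_dn (csub \<theta>' \<Xi> + \<Xi>') (fsub (scomp \<sigma> (scomp \<theta> \<theta>')) (Tensor A' B'))"
        using 1 2 * assms by (simp add: fsub_fsub[of "[]"] scomp_assoc tensor_dn)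
      then have "foc_up (csub (scomp \<theta> \<theta>') \<Gamma> + (csub \<theta>' \<Xi> + \<Xi>')) (msub (scomp \<theta> \<theta>') \<Delta>)"
        using 1 2 by (intro *(4)) auto
      then show "foc_up (csub \<theta>' (csub \<theta> \<Gamma> + \<Xi>) + \<Xi>') (msub \<theta>' (msub \<theta> \<Delta>))"
        using 1 2 * by (simp add: csub_csub msub_msub ac_simps)
    qed (use 1 * assms in auto)
    then show "foc_up (csub \<theta> \<Gamma> + \<Xi>) (msub \<theta> (add_mset (fsub \<sigma> B) \<Delta>))"
      using 1 * assms by (simp add: fsub_fsub[of "[]"])
  qed (use * assms in auto)
  then show "foc_up \<Gamma> (add_mset (fsub \<sigma> (Par A B)) \<Delta>)" by (simp add: par_up)
qed

lemma lk_with: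
  assumes "lk A A'" "lk B B'"
  shows "lk (With A B) (Plus A' B')"
proof (rule lkI)
  fix \<sigma> \<Gamma> \<Delta>
  assume *: "is_sbst \<sigma>" "wfc \<Gamma>" "wfs \<Delta>"
    "\<And>\<theta> \<Xi>. is_sbst \<theta> \<Longrightarrow> wfc \<Xi> \<Longrightarrow> foc_dn \<Xi> (fsub (scomp \<sigma> \<theta>) (Plus A' B')) \<Longrightarrow>
        foc_up (csub \<theta> \<Gamma> + \<Xi>) (msub \<theta> \<Delta>)"
  have "foc_up \<Gamma> (add_mset (fsub \<sigma> A) \<Delta>)"
    by (rule lkD[OF assms(1) *(1-3)]) (auto intro!: *(4) plus1_dn)
  moreover have "foc_up \<Gamma> (add_mset (fsub \<sigma> B) \<Delta>)"
    by (rule lkD[OF assms(2) *(1-3)]) (auto intro!: *(4) plus2_dn)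
  ultimately show "foc_up \<Gamma> (add_mset (fsub \<sigma> (With A B)) \<Delta>)" by (simp add: with_up)
qed

lemma lk_bot: "lk Bot One"
proof (rule lkI)
  fix \<sigma> \<Gamma> \<Delta>
  assume *: "is_sbst \<sigma>" "wfc \<Gamma>" "wfs \<Delta>"
    "\<And>\<theta> \<Xi>. is_sbst \<theta> \<Longrightarrow> wfc \<Xi> \<Longrightarrow> foc_dn \<Xi> (fsub (scomp \<sigma> \<theta>) One) \<Longrightarrow>
        foc_up (csub \<theta> \<Gamma> + \<Xi>) (msub \<theta> \<Delta>)"
  show "foc_up \<Gamma> (add_mset (fsub \<sigma> Bot) \<Delta>)"
    using *(4)[of var "{#}"] * by (simp add: one_dn bot_up)
qed

lemma lk_top: "lk Top Zero"
  by (rule lkI) (simp add: top_up)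

text \<open>Reads off a witness from an instance of a premise with an eigenvariable: the value
  \<open>\<theta> s 0\<close> instantiates the quantifier, and what \<theta> does to the shifted
  variables acts on the rest.\<close>

lemma fsub_eta:
  assumes "formula P" "is_sbst \<sigma>" "is_sbst \<theta>"
  shows "fsub (scomp (ups [s] \<sigma>) \<theta>) P
    = fsub (inst [s] [\<theta> s 0]) (fsub (ups [s] (scomp \<sigma> (scomp (shift [s]) \<theta>))) P)"
proof -
  have "well_sorted [\<theta> s 0] [s]" using assms by (simp add: is_sbst_def)
  moreover have "\<theta> = sconss [s] [\<theta> s 0] (scomp (shift [s]) \<theta>)"
    using sconss_eta[of \<theta> "[s]"] assms(3) by simp
  ultimately have "scomp (ups [s] \<sigma>) \<theta> = sconss [s] [\<theta> s 0] (scomp \<sigma> (scomp (shift [s]) \<theta>))"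
    using ups_sconss_comp[of "[\<theta> s 0]" "[s]" \<sigma> "scomp (shift [s]) \<theta>"] assms by auto
  with \<open>well_sorted _ _\<close> show ?thesis
    using assms by (simp add: fsub_fsub[of "[]"] ups_inst del: well_sorted_single sconss.simps)
qed

lemma lk_all:
  assumes "lk P P'" "formula P" "formula P'"
  shows "lk (All s P) (Ex s P')"
proof (rule lkI)
  fix \<sigma> \<Gamma> \<Delta>
  assume *: "is_sbst \<sigma>" "wfc \<Gamma>" "wfs \<Delta>"
    "\<And>\<theta> \<Xi>. is_sbst \<theta> \<Longrightarrow> wfc \<Xi> \<Longrightarrow> foc_dn \<Xi> (fsub (scomp \<sigma> \<theta>) (Ex s P')) \<Longrightarrow>
        foc_up (csub \<theta> \<Gamma> + \<Xi>) (msub \<theta> \<Delta>)"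
  have "foc_up (csub (shift [s]) \<Gamma>) (add_mset (fsub (ups [s] \<sigma>) P) (msub (shift [s]) \<Delta>))"
  proof (rule lkD[OF assms(1)])
    fix \<theta> \<Xi> assume 1: "is_sbst \<theta>" "wfc \<Xi>" "foc_dn \<Xi> (fsub (scomp (ups [s] \<sigma>) \<theta>) P')"
    then have "foc_dn \<Xi> (fsub (scomp \<sigma> (scomp (shift [s]) \<theta>)) (Ex s P'))"
      using fsub_eta[of P' \<sigma> \<theta> s] assms * ex_dn[of "\<theta> s 0" s \<Xi>] by (auto simp: is_sbst_def)
    then have "foc_up (csub (scomp (shift [s]) \<theta>) \<Gamma> + \<Xi>) (msub (scomp (shift [s]) \<theta>) \<Delta>)"
      using 1 by (intro *(4)) auto
    then show "foc_up (csub \<theta> (csub (shift [s]) \<Gamma>) + \<Xi>) (msub \<theta> (msub (shift [s]) \<Delta>))"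
      using 1 * by (simp add: csub_csub msub_msub)
  qed (use * in auto)
  then show "foc_up \<Gamma> (add_mset (fsub \<sigma> (All s P)) \<Delta>)" by (simp add: all_up)
qed

lemma lk_neq:
  assumes "t \<in> Tm s" "u \<in> Tm s"
  shows "lk (Neq s t u) (Eq s t u)"
proof (rule lkI)
  fix \<sigma> \<Gamma> \<Delta>
  assume *: "is_sbst \<sigma>" "wfc \<Gamma>" "wfs \<Delta>"
    "\<And>\<theta> \<Xi>. is_sbst \<theta> \<Longrightarrow> wfc \<Xi> \<Longrightarrow> foc_dn \<Xi> (fsub (scomp \<sigma> \<theta>) (Eq s t u)) \<Longrightarrow>
        foc_up (csub \<theta> \<Gamma> + \<Xi>) (msub \<theta> \<Delta>)"
  have "foc_up (csub \<theta> \<Gamma>) (msub \<theta> \<Delta>)" if "unifier (tsub \<sigma> t) (tsub \<sigma> u) \<theta>" for \<theta>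
    using *(4)[of \<theta> "{#}"] that * tsub_scomp[of \<sigma> \<theta> t s] tsub_scomp[of \<sigma> \<theta> u s] assms
    by (auto simp: unifier_def eq_dn)
  then show "foc_up \<Gamma> (add_mset (fsub \<sigma> (Neq s t u)) \<Delta>)"
    using neq_up[OF csu_unifiers, of "tsub \<sigma> t" "tsub \<sigma> u"] by simp
qed

lemma lk_natom:
  assumes "well_sorted ts (ar a)"
  shows "lk (NAtom a ts) (Atom a ts)"
proof (rule lkI)
  fix \<sigma> \<Gamma> \<Delta>
  assume *: "is_sbst \<sigma>" "wfc \<Gamma>" "wfs \<Delta>"
    "\<And>\<theta> \<Xi>. is_sbst \<theta> \<Longrightarrow> wfc \<Xi> \<Longrightarrow> foc_dn \<Xi> (fsub (scomp \<sigma> \<theta>) (Atom a ts)) \<Longrightarrow>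
        foc_up (csub \<theta> \<Gamma> + \<Xi>) (msub \<theta> \<Delta>)"
  show "foc_up \<Gamma> (add_mset (fsub \<sigma> (NAtom a ts)) \<Delta>)"
    using *(4)[of var "{#Frozen (NAtom a (map (tsub \<sigma>) ts))#}"] * assms
    by (simp add: natom_freeze atom_dn)
qed

text \<open>
  The frozen \<open>\<mu>E\<close> is matched by the axiom against the coinvariant \<open>(\<mu>E)\<^sup>\<bottom>\<close>, whose invariance is
  the hypothesis.
\<close>

lemma lk_mu:
  assumes "wf [ss] E" "wf [ss] F" "well_sorted ts ss"
    and "lk (papp ss E (mupred ss E)) (papp ss F (neg (mupred ss E)))"
  shows "lk (Mu ss E ts) (Nu ss F ts)"
proof (rule lkI)
  fix \<sigma> \<Gamma> \<Delta>
  assume *: "is_sbst \<sigma>" "wfc \<Gamma>" "wfs \<Delta>"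
    "\<And>\<theta> \<Xi>. is_sbst \<theta> \<Longrightarrow> wfc \<Xi> \<Longrightarrow> foc_dn \<Xi> (fsub (scomp \<sigma> \<theta>) (Nu ss F ts)) \<Longrightarrow>
        foc_up (csub \<theta> \<Gamma> + \<Xi>) (msub \<theta> \<Delta>)"
  define E' F' ts' where defs: "E' = plift ss \<sigma> E" "F' = plift ss \<sigma> F" "ts' = map (tsub \<sigma>) ts"
  have wfs': "wf [ss] E'" "wf [ss] F'" "well_sorted ts' ss" using assms * by (auto simp: defs)
  have "foc_up {#} {#plift ss \<sigma> (papp ss E (mupred ss E)), plift ss \<sigma> (papp ss F (neg (mupred ss E)))#}"
    unfolding plift_def using assms * by (intro lk_up) auto
  then have "foc_up {#} {#papp ss E' (mupred ss E'), papp ss F' (neg (mupred ss E'))#}"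
    using assms * plift_mupred[of ss E \<sigma>]
    by (simp add: plift_papp defs) (simp add: plift_def neg_fsub[symmetric])
  then have "foc_up {#} {#mupred ss E', papp ss F' (neg (mupred ss E'))#}"
    using unfold_mu_bvars[OF wfs'(1)] by (simp add: mupred_def mu_unfold)
  moreover have "fsub (inst ss ts') (neg (mupred ss E')) = Nu ss (neg E') ts'"
    using mupred_sconss[of ss E' var ts'] wfs'
    by (simp add: neg_fsub[symmetric] inst_sconss) (simp add: plift_def fsub_var[of "[ss]"])
  moreover have "foc_dn {#Frozen (Mu ss E' ts')#} (Nu ss (neg E') ts')"
    using nu_ax[of ss "neg E'"] by simp
  ultimately have "foc_dn {#Frozen (Mu ss E' ts')#} (Nu ss F' ts')"
    using wfs' by (intro nu_coind[where S = "neg (mupred ss E')"]) (simp_all add: add_mset_commute)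
  then have "foc_up (csub var \<Gamma> + {#Frozen (Mu ss E' ts')#}) (msub var \<Delta>)"
    using * wfs' by (intro *(4)) (simp_all add: defs plift_def)
  then show "foc_up \<Gamma> (add_mset (fsub \<sigma> (Mu ss E ts)) \<Delta>)"
    using * by (simp add: defs plift_def mu_freeze)
qed

text \<open>Freezing and the axiom suffice, with no recursion into the operator. This supplies the
  linked pair for the recursion variable in the induction on operator bodies.\<close>

lemma lk_mu_neg:
  assumes "wf [ss] B" "well_sorted ts ss"
  shows "lk (Mu ss B ts) (neg (Mu ss B ts))"
proof (rule lkI)
  fix \<sigma> \<Gamma> \<Delta>
  assume *: "is_sbst \<sigma>" "wfc \<Gamma>" "wfs \<Delta>"
    "\<And>\<theta> \<Xi>. is_sbst \<theta> \<Longrightarrow> wfc \<Xi> \<Longrightarrow> foc_dn \<Xi> (fsub (scomp \<sigma> \<theta>) (neg (Mu ss B ts))) \<Longrightarrow>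
        foc_up (csub \<theta> \<Gamma> + \<Xi>) (msub \<theta> \<Delta>)"
  have "foc_up (csub var \<Gamma> + {#Frozen (fsub \<sigma> (Mu ss B ts))#}) (msub var \<Delta>)"
    using * assms nu_ax[of ss "neg (fsub (ups ss \<sigma>) B)"]
    by (intro *(4)) (simp_all add: neg_fsub)
  then show "foc_up \<Gamma> (add_mset (fsub \<sigma> (Mu ss B ts)) \<Delta>)"
    using * by (simp add: mu_freeze)
qed

section \<open>Functoriality of operators\<close>

text \<open>The second list serves as a list of duals of the first. Both directions are needed since
  the side that is decomposed asynchronously changes with the polarity of the connective.\<close>

definition linked :: "('s list \<times> ('s, 't, 'a) form) list \<Rightarrow> ('s list \<times> ('s, 't, 'a) form) list \<Rightarrow> bool" where
  "linked = list_all2 (\<lambda>x y. fst x = fst y \<and> formula (snd x) \<and> formula (snd y) \<and>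
     lk (snd x) (snd y) \<and> lk (snd y) (snd x))"

lemma linkedD:
  assumes "linked Xs Ys"
  shows "preds Xs" "preds Ys" "map fst Ys = map fst Xs" "length Ys = length Xs"
    and "i < length Xs \<Longrightarrow> fst (Ys ! i) = fst (Xs ! i) \<and>
      lk (snd (Xs ! i)) (snd (Ys ! i)) \<and> lk (snd (Ys ! i)) (snd (Xs ! i))"
proof -
  show "preds Xs" "preds Ys" "map fst Ys = map fst Xs" "length Ys = length Xs"
    using assms unfolding linked_def by (induction Xs Ys rule: list_all2_induct) auto
  show "i < length Xs \<Longrightarrow> fst (Ys ! i) = fst (Xs ! i) \<and>
      lk (snd (Xs ! i)) (snd (Ys ! i)) \<and> lk (snd (Ys ! i)) (snd (Xs ! i))"
    using list_all2_nthD[OF assms[unfolded linked_def], of i] by simp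
qed

lemma linked_plifts: "linked Xs Ys \<Longrightarrow> is_sbst \<sigma> \<Longrightarrow> linked (plifts \<sigma> Xs) (plifts \<sigma> Ys)"
  unfolding linked_def by (induction Xs Ys rule: list_all2_induct) (simp_all add: lk_plift)

text \<open>Adds the recursion variable of an operator. The least fixed point goes to the first list
  for a \<open>Mu\<close> body and to the second for a \<open>Nu\<close> body.\<close>

lemma linked_mupred:
  assumes "linked Xs Ys" "wf [ss] B"
  shows "linked ((ss, plift ss (shift ss) (mupred ss B)) # plifts (shift ss) Xs)
                ((ss, plift ss (shift ss) (neg (mupred ss B))) # plifts (shift ss) Ys)"
    and "linked ((ss, plift ss (shift ss) (neg (mupred ss B))) # plifts (shift ss) Xs)
                ((ss, plift ss (shift ss) (mupred ss B)) # plifts (shift ss) Ys)"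
proof -
  have 1: "lk (mupred ss B) (neg (mupred ss B))"
    using assms unfolding mupred_def by (intro lk_mu_neg) auto
  then have "lk (neg (mupred ss B)) (mupred ss B)"
    using assms by (simp add: mupred_def lk_sync)
  with 1 show "linked ((ss, plift ss (shift ss) (mupred ss B)) # plifts (shift ss) Xs)
                ((ss, plift ss (shift ss) (neg (mupred ss B))) # plifts (shift ss) Ys)"
    "linked ((ss, plift ss (shift ss) (neg (mupred ss B))) # plifts (shift ss) Xs)
                ((ss, plift ss (shift ss) (mupred ss B)) # plifts (shift ss) Ys)"
    using assms linked_plifts[OF assms(1), of "shift ss"]
    by (simp_all add: linked_def lk_plift)
qed

text \<open>An application of the partially replaced operator becomes a single replacement in
  \<open>B\<close> itself, the shape of the induction hypothesis for \<open>B\<close>.\<close>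

lemma papp_psubs:
  assumes "wf (ss # map fst Xs) B" "preds Xs" "formula S"
  shows "papp ss (psubs (Suc 0) (plifts (shift ss) Xs) B) S
    = psubs 0 ((ss, plift ss (shift ss) S) # plifts (shift ss) Xs) B"
  using assms unfolding papp_def by (intro psub_psubs) auto

text \<open>Empty lists give identity expansion; a linked pair for the recursion variable gives
  functoriality. The induction is structural because the recursion variable is mapped to a closed
  fixed point and its dual, already linked by the axiom.\<close>

lemma lk_psubs:
  "wf (map fst Xs) D \<Longrightarrow> linked Xs Ys \<Longrightarrow>
    lk (psubs 0 Xs D) (psubs 0 Ys (neg D)) \<and> lk (psubs 0 Ys (neg D)) (psubs 0 Xs D)"
proof (induction D arbitrary: Xs Ys)
  case (Tensor A B)
  note L = linkedD[OF Tensor.prems(2)]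
  have wfs': "formula (psubs 0 Xs A)" "formula (psubs 0 Ys (neg A))"
    "formula (psubs 0 Xs B)" "formula (psubs 0 Ys (neg B))"
    using Tensor.prems L by (auto intro!: wf_psubs)
  have "lk (Par (psubs 0 Ys (neg A)) (psubs 0 Ys (neg B))) (Tensor (psubs 0 Xs A) (psubs 0 Xs B))"
    using Tensor wfs' by (intro lk_par) auto
  then show ?case using wfs' by (auto intro: lk_sync)
next
  case (Par A B)
  note L = linkedD[OF Par.prems(2)]
  have wfs': "formula (psubs 0 Xs A)" "formula (psubs 0 Ys (neg A))"
    "formula (psubs 0 Xs B)" "formula (psubs 0 Ys (neg B))"
    using Par.prems L by (auto intro!: wf_psubs)
  have "lk (Par (psubs 0 Xs A) (psubs 0 Xs B)) (Tensor (psubs 0 Ys (neg A)) (psubs 0 Ys (neg B)))"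
    using Par wfs' by (intro lk_par) auto
  then show ?case using wfs' by (auto intro: lk_sync)
next
  case (Plus A B)
  note L = linkedD[OF Plus.prems(2)]
  have wfs': "formula (psubs 0 Xs A)" "formula (psubs 0 Ys (neg A))"
    "formula (psubs 0 Xs B)" "formula (psubs 0 Ys (neg B))"
    using Plus.prems L by (auto intro!: wf_psubs)
  have "lk (With (psubs 0 Ys (neg A)) (psubs 0 Ys (neg B))) (Plus (psubs 0 Xs A) (psubs 0 Xs B))"
    using Plus by (intro lk_with) auto
  then show ?case using wfs' by (auto intro: lk_sync)
next
  case (With A B)
  note L = linkedD[OF With.prems(2)]
  have wfs': "formula (psubs 0 Xs A)" "formula (psubs 0 Ys (neg A))"
    "formula (psubs 0 Xs B)" "formula (psubs 0 Ys (neg B))"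
    using With.prems L by (auto intro!: wf_psubs)
  have "lk (With (psubs 0 Xs A) (psubs 0 Xs B)) (Plus (psubs 0 Ys (neg A)) (psubs 0 Ys (neg B)))"
    using With by (intro lk_with) auto
  then show ?case using wfs' by (auto intro: lk_sync)
next
  case (Ex s P)
  let ?Xs = "plifts (shift [s]) Xs" and ?Ys = "plifts (shift [s]) Ys"
  have L: "linked ?Xs ?Ys" using Ex.prems by (simp add: linked_plifts)
  have wfs': "formula (psubs 0 ?Xs P)" "formula (psubs 0 ?Ys (neg P))"
    using Ex.prems linkedD[OF Ex.prems(2)] by (auto intro!: wf_psubs)
  have "lk (All s (psubs 0 ?Ys (neg P))) (Ex s (psubs 0 ?Xs P))"
    using Ex L wfs' by (intro lk_all) auto
  then show ?case using wfs' by (auto intro: lk_sync)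
next
  case (All s P)
  let ?Xs = "plifts (shift [s]) Xs" and ?Ys = "plifts (shift [s]) Ys"
  have L: "linked ?Xs ?Ys" using All.prems by (simp add: linked_plifts)
  have wfs': "formula (psubs 0 ?Xs P)" "formula (psubs 0 ?Ys (neg P))"
    using All.prems linkedD[OF All.prems(2)] by (auto intro!: wf_psubs)
  have "lk (All s (psubs 0 ?Xs P)) (Ex s (psubs 0 ?Ys (neg P)))"
    using All L wfs' by (intro lk_all) auto
  then show ?case using wfs' by (auto intro: lk_sync)
next
  case (PVar i ts)
  note L = linkedD[OF PVar.prems(2)]
  have "well_sorted ts (fst (Xs ! i))" "i < length Xs" using PVar.prems by auto
  then show ?case using L by (auto simp: psubs_PVar list_all_length intro!: lk_fsub)
next
  case (Mu ss D ts)
  note L = linkedD[OF Mu.prems(2)]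
  define E where "E = psubs (Suc 0) (plifts (shift ss) Xs) D"
  define F where "F = psubs (Suc 0) (plifts (shift ss) Ys) (neg D)"
  have wfs': "wf [ss] E" "wf [ss] F" "well_sorted ts ss"
    unfolding E_def F_def using Mu.prems L by (auto intro!: wf_psubs)
  let ?M = "mupred ss E"
  \<comment> \<open>The invariance demanded by \<open>lk_mu\<close> is the induction hypothesis for
    \<open>D\<close>, with the recursion variable mapped to \<open>?M\<close> on one side and to
    \<open>neg ?M\<close> on the other.\<close>
  have "lk (papp ss E ?M) (papp ss F (neg ?M))"
    unfolding E_def F_def using Mu.prems L wfs' Mu.IH[OF _ linked_mupred(1)[OF Mu.prems(2) wfs'(1)]]
    by (simp add: papp_psubs E_def)
  then have 1: "lk (Mu ss E ts) (Nu ss F ts)" using wfs' by (intro lk_mu)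
  then have "lk (Nu ss F ts) (Mu ss E ts)" using wfs' by (simp add: lk_sync)
  with 1 show ?case by (simp add: E_def F_def)
next
  case (Nu ss D ts)
  note L = linkedD[OF Nu.prems(2)]
  define E where "E = psubs (Suc 0) (plifts (shift ss) Xs) D"
  define F where "F = psubs (Suc 0) (plifts (shift ss) Ys) (neg D)"
  have wfs': "wf [ss] E" "wf [ss] F" "well_sorted ts ss"
    unfolding E_def F_def using Nu.prems L by (auto intro!: wf_psubs)
  let ?M = "mupred ss F"
  \<comment> \<open>The least fixed point is now the dual one, so the added pair is in the opposite
    order.\<close>
  have "lk (papp ss F ?M) (papp ss E (neg ?M))"
    unfolding E_def F_def using Nu.prems L wfs' Nu.IH[OF _ linked_mupred(2)[OF Nu.prems(2) wfs'(2)]]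
    by (simp add: papp_psubs F_def)
  then have 1: "lk (Mu ss F ts) (Nu ss E ts)" using wfs' by (intro lk_mu)
  then have "lk (Nu ss E ts) (Mu ss F ts)" using wfs' by (simp add: lk_sync)
  with 1 show ?case by (simp add: E_def F_def)
next
  case (Eq s t u)
  then show ?case using lk_neq[of t s u] by (auto intro: lk_sync)
next
  case (Neq s t u)
  then show ?case using lk_neq[of t s u] by (auto intro: lk_sync)
next
  case (Atom a ts)
  then show ?case using lk_natom[of ts a] by (auto intro: lk_sync)
next
  case (NAtom a ts)
  then show ?case using lk_natom[of ts a] by (auto intro: lk_sync)
qed (use lk_bot lk_top in \<open>auto intro: lk_sync\<close>)

lemma lk_neg: "formula A \<Longrightarrow> lk A (neg A)"
  using lk_psubs[of "[]" A "[]"] by (simp add: linked_def)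

section \<open>Unfolded least fixed points and their duals\<close>

lemma mupred_fsub:
  assumes "wf [ss] B" "is_sbst \<sigma>"
  obtains B' ts where "fsub \<sigma> (mupred ss B) = Mu ss B' ts"
    "fsub \<sigma> (papp ss B (mupred ss B)) = unfold_mu ss B' ts"
proof
  have \<sigma>: "sconss ss (map (tsub \<sigma>) (bvars ss)) (scomp (shift ss) \<sigma>) = \<sigma>"
    using assms by (simp add: sconss_eta)
  show "fsub \<sigma> (mupred ss B) = Mu ss (plift ss (scomp (shift ss) \<sigma>) B) (map (tsub \<sigma>) (bvars ss))"
    using mupred_sconss[of ss B "scomp (shift ss) \<sigma>" "map (tsub \<sigma>) (bvars ss)"] assms \<sigma> by simp
  show "fsub \<sigma> (papp ss B (mupred ss B))
      = unfold_mu ss (plift ss (scomp (shift ss) \<sigma>) B) (map (tsub \<sigma>) (bvars ss))"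
    using unfold_mu_sconss[of ss B "scomp (shift ss) \<sigma>" "map (tsub \<sigma>) (bvars ss)"] assms \<sigma> by simp
qed

text \<open>Identity expansion links \<open>U\<close> and \<open>neg U\<close>, and
  \<open>mu_unfold\<close> lets \<open>M\<close> stand in for \<open>U\<close>. In the second
  direction, a context proving \<open>U\<close> under focus proves \<open>M\<close> under focus:
  \<open>M\<close> is released and then unfolded.\<close>

lemma lk_unfold:
  assumes "wf [ss] B"
  defines "M \<equiv> mupred ss B" and "U \<equiv> papp ss B (mupred ss B)"
  shows "lk M (neg U)" and "lk (neg U) M"
proof -
  have wfU: "formula U" using assms by simp
  show "lk M (neg U)"
  proof (rule lkI)
    fix \<sigma> \<Gamma> \<Delta>
    assume *: "is_sbst \<sigma>" "wfc \<Gamma>" "wfs \<Delta>"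
      "\<And>\<theta> \<Xi>. is_sbst \<theta> \<Longrightarrow> wfc \<Xi> \<Longrightarrow> foc_dn \<Xi> (fsub (scomp \<sigma> \<theta>) (neg U)) \<Longrightarrow>
          foc_up (csub \<theta> \<Gamma> + \<Xi>) (msub \<theta> \<Delta>)"
    obtain B' ts where "fsub \<sigma> M = Mu ss B' ts" "fsub \<sigma> U = unfold_mu ss B' ts"
      unfolding M_def U_def using mupred_fsub[OF assms(1) *(1)] .
    moreover have "foc_up \<Gamma> (add_mset (fsub \<sigma> U) \<Delta>)"
      by (rule lkD[OF lk_neg[OF wfU]]) (use * in auto)
    ultimately show "foc_up \<Gamma> (add_mset (fsub \<sigma> M) \<Delta>)" by (simp add: mu_unfold)
  qed
  show "lk (neg U) M"
  proof (rule lkI)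
    fix \<sigma> \<Gamma> \<Delta>
    assume *: "is_sbst \<sigma>" "wfc \<Gamma>" "wfs \<Delta>"
      "\<And>\<theta> \<Xi>. is_sbst \<theta> \<Longrightarrow> wfc \<Xi> \<Longrightarrow> foc_dn \<Xi> (fsub (scomp \<sigma> \<theta>) M) \<Longrightarrow>
          foc_up (csub \<theta> \<Gamma> + \<Xi>) (msub \<theta> \<Delta>)"
    have "lk (neg U) U" using lk_neg[of "neg U"] wfU by simp
    then show "foc_up \<Gamma> (add_mset (fsub \<sigma> (neg U)) \<Delta>)"
    proof (rule lkD[OF _ *(1-3)])
      fix \<theta> \<Xi> assume 1: "is_sbst \<theta>" "wfc \<Xi>" "foc_dn \<Xi> (fsub (scomp \<sigma> \<theta>) U)"
      obtain B' ts where "fsub (scomp \<sigma> \<theta>) M = Mu ss B' ts" "fsub (scomp \<sigma> \<theta>) U = unfold_mu ss B' ts"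
        unfolding M_def U_def using mupred_fsub[OF assms(1), of "scomp \<sigma> \<theta>"] * 1 by auto
      with foc_dn_up[OF 1(3)] have "foc_dn \<Xi> (fsub (scomp \<sigma> \<theta>) M)"
        by (simp add: release mu_unfold)
      with 1 show "foc_up (csub \<theta> \<Gamma> + \<Xi>) (msub \<theta> \<Delta>)" by (intro *(4))
    qed
  qed
qed

lemma foc_dn_nu_unfold:
  assumes "wf [ss] B" "foc_dn \<Gamma> (neg (unfold_mu ss B ts))"
  shows "foc_dn \<Gamma> (Nu ss (neg B) ts)"
proof -
  define M U where MU: "M = mupred ss B" "U = papp ss B M"
  have wfs': "formula M" "formula U" using assms by (simp_all add: MU)
  \<comment> \<open>Functoriality is applied to the pair \<open>M\<close>, \<open>neg U\<close>:
    \<open>B\<close> turns the first into \<open>U\<close> itself, and \<open>neg B\<close> turns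
    the second into the coinvariant's image, which is the required invariance.\<close>
  have "linked [(ss, plift ss (shift ss) M)] [(ss, plift ss (shift ss) (neg U))]"
    using wfs' lk_unfold[OF assms(1)] by (simp add: linked_def lk_plift MU)
  from lk_psubs[OF _ this, of B] have "lk U (papp ss (neg B) (neg U))"
    using assms by (simp add: papp_def MU)
  from lk_up[OF this, of var] have "foc_up {#} {#papp ss (neg B) (neg U), neg (neg U)#}"
    using wfs' assms by (simp add: fsub_var[of "[]"] add_mset_commute)
  moreover have "foc_dn \<Gamma> (fsub (inst ss ts) (neg U))"
    using assms by (simp add: unfold_mu_alt neg_fsub MU)
  ultimately show ?thesis using wfs' by (intro nu_coind[where S = "neg U"]) auto
qed

section \<open>Leaves of the asynchronous phase\<close>

text \<open>
  \<open>leaf k P \<Gamma>\<close>: \<open>\<Gamma>\<close> is what remains of \<open>P\<close> on some branch of the asynchronous phase in which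
  every least fixed point is unfolded as long as the fuel \<open>k\<close> lasts and then frozen. The branches of
  \<open>\<forall>\<close> and \<open>\<noteq>\<close> are all their instances.
\<close>

inductive leaf :: "nat \<Rightarrow> ('s, 't, 'a) form \<Rightarrow> ('s, 't, 'a) item multiset \<Rightarrow> bool" where
  leaf_sync: "\<not> async P \<Longrightarrow> leaf k P {#Plain P#}"
| leaf_par: "leaf k P \<Gamma> \<Longrightarrow> leaf k Q \<Gamma>' \<Longrightarrow> leaf k (Par P Q) (\<Gamma> + \<Gamma>')"
| leaf_with1: "leaf k P \<Gamma> \<Longrightarrow> leaf k (With P Q) \<Gamma>"
| leaf_with2: "leaf k Q \<Gamma> \<Longrightarrow> leaf k (With P Q) \<Gamma>"
| leaf_bot: "leaf k Bot {#}"
| leaf_all: "t \<in> Tm s \<Longrightarrow> leaf k (fsub (inst [s] [t]) P) \<Gamma> \<Longrightarrow> leaf k (All s P) \<Gamma>"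
| leaf_neq: "leaf k (Neq s t t) {#}"
| leaf_natom: "leaf k (NAtom a ts) {#Frozen (NAtom a ts)#}"
| leaf_freeze: "leaf 0 (Mu ss B ts) {#Frozen (Mu ss B ts)#}"
| leaf_unfold: "leaf k (unfold_mu ss B ts) \<Gamma> \<Longrightarrow> leaf (Suc k) (Mu ss B ts) \<Gamma>"

inductive_cases leaf_elims:
  "leaf k (Par P Q) \<Gamma>" "leaf k (With P Q) \<Gamma>" "leaf k Bot \<Gamma>" "leaf k Top \<Gamma>" "leaf k (All s P) \<Gamma>"
  "leaf k (Neq s t u) \<Gamma>" "leaf (Suc k) (Mu ss B ts) \<Gamma>"

lemma leaf_syncD: "leaf k P \<Gamma> \<Longrightarrow> \<not> async P \<Longrightarrow> \<Gamma> = {#Plain P#}"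
  by (induction rule: leaf.induct) auto

lemma leaf_wf: "leaf k P \<Gamma> \<Longrightarrow> formula P \<Longrightarrow> wfc \<Gamma>"
  by (induction rule: leaf.induct) auto

lemma leaf_sub: "leaf k P \<Gamma> \<Longrightarrow> formula P \<Longrightarrow> is_sbst \<sigma> \<Longrightarrow> leaf k (fsub \<sigma> P) (csub \<sigma> \<Gamma>)"
proof (induction rule: leaf.induct)
  case (leaf_sync P k)
  then show ?case using leaf.leaf_sync[of "fsub \<sigma> P"] by simp
next
  case (leaf_all t s k P \<Gamma>)
  then show ?case
    using fsub_inst[of "[]" P "[t]" "[s]" \<sigma>] leaf.leaf_all[of "tsub \<sigma> t" s k] by (simp add: is_sbst_Tm)
next
  case (leaf_unfold k ss B ts \<Gamma>)
  then show ?case by (simp add: fsub_unfold_mu leaf.leaf_unfold)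
qed (auto intro: leaf.intros)

text \<open>The choices recorded in a leaf are replayed dually: a sum of contexts is a tensor split,
  a branch of \<open>With\<close> is a choice in \<open>Plus\<close>, an instance is an existential
  witness. A frozen least fixed point meets the axiom, an unfolded one
  \<open>foc_dn_nu_unfold\<close>.\<close>

lemma leaf_dn: "leaf k P \<Gamma> \<Longrightarrow> formula P \<Longrightarrow> foc_dn \<Gamma> (neg P)"
proof (induction rule: leaf.induct)
  case (leaf_sync P k)
  then have "lk (neg P) P" using lk_neg[of "neg P"] by simp
  with leaf_sync show ?case
    using lk_sync_dn[of "neg P" P var] by (simp add: async_neg fsub_var[of "[]"])
next
  case (leaf_all t s k P \<Gamma>)
  then show ?case by (auto simp: neg_fsub intro: ex_dn)
next
  case (leaf_freeze ss B ts)
  then show ?case using nu_ax[of ss "neg B" ts] by simp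
next
  case (leaf_unfold k ss B ts \<Gamma>)
  then show ?case by (simp add: foc_dn_nu_unfold)
qed (auto intro: foc_up_foc_dn.intros)

text \<open>The induction is lexicographic in fuel and size: unfolding may enlarge the formula but
  spends fuel, whereas every other decomposition keeps the fuel and shrinks the formula.\<close>

lemma foc_up_leaves:
  "formula P \<Longrightarrow> wfc \<Gamma> \<Longrightarrow> wfs \<Delta> \<Longrightarrow>
    (\<And>\<theta> \<gamma>. is_sbst \<theta> \<Longrightarrow> leaf k (fsub \<theta> P) \<gamma> \<Longrightarrow> foc_up (csub \<theta> \<Gamma> + \<gamma>) (msub \<theta> \<Delta>)) \<Longrightarrow>
    foc_up \<Gamma> (add_mset P \<Delta>)"
proof (induction "(k, P)" arbitrary: k P \<Gamma> \<Delta> rule: wf_induct_rule[OF wf_lex_prod[OF wf_less_than wf_measure[of size]]])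
  case (1 k P \<Gamma> \<Delta>)
  note wfP = 1(2) and wf\<Gamma> = 1(3) and wf\<Delta> = 1(4) and H = 1(5)
  have IH: "foc_up \<Gamma>' (add_mset P' \<Delta>')"
    if "size P' < size P \<or> k' < k" "k' \<le> k" "formula P'" "wfc \<Gamma>'" "wfs \<Delta>'"
      "\<And>\<theta> \<gamma>. is_sbst \<theta> \<Longrightarrow> leaf k' (fsub \<theta> P') \<gamma> \<Longrightarrow> foc_up (csub \<theta> \<Gamma>' + \<gamma>) (msub \<theta> \<Delta>')"
    for k' P' \<Gamma>' \<Delta>'
    using that by (intro 1(1)[of k' P']) auto
  have H0: "foc_up (\<Gamma> + \<gamma>) \<Delta>" if "leaf k P \<gamma>" for \<gamma>
    using H[of var \<gamma>] that wfP wf\<Gamma> wf\<Delta> by (simp add: fsub_var[of "[]"])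
  show ?case
  proof (cases "async P")
    case False
    with H0[OF leaf_sync[of P k]] show ?thesis by (simp add: store)
  next
    case True
    then show ?thesis
    proof (cases P)
      case (Par A B)
      have "foc_up \<Gamma> (add_mset A (add_mset B \<Delta>))"
      proof (rule IH[of _ k])
        fix \<theta> \<gamma> assume 1: "is_sbst \<theta>" "leaf k (fsub \<theta> A) \<gamma>"
        have "foc_up (csub \<theta> \<Gamma> + \<gamma>) (add_mset (fsub \<theta> B) (msub \<theta> \<Delta>))"
        proof (rule IH[of _ k])
          fix \<theta>' \<gamma>' assume 2: "is_sbst \<theta>'" "leaf k (fsub \<theta>' (fsub \<theta> B)) \<gamma>'"
          have "leaf k (fsub (scomp \<theta> \<theta>') P) (csub \<theta>' \<gamma> + \<gamma>')"
            using 1 2 leaf_sub[OF 1(2), of \<theta>'] wfP Par by (simp add: fsub_fsub[of "[]"] leaf_par)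
          from H[OF _ this] show "foc_up (csub \<theta>' (csub \<theta> \<Gamma> + \<gamma>) + \<gamma>') (msub \<theta>' (msub \<theta> \<Delta>))"
            using 1 2 wf\<Gamma> wf\<Delta> by (simp add: csub_csub msub_msub ac_simps)
        qed (use 1 leaf_wf[OF 1(2)] wfP wf\<Gamma> wf\<Delta> Par in auto)
        then show "foc_up (csub \<theta> \<Gamma> + \<gamma>) (msub \<theta> (add_mset B \<Delta>))" by simp
      qed (use wfP wf\<Gamma> wf\<Delta> Par in auto)
      then show ?thesis using Par by (simp add: par_up)
    next
      case (With A B)
      have "foc_up \<Gamma> (add_mset A \<Delta>)"
        by (rule IH[of _ k]) (use wfP wf\<Gamma> wf\<Delta> With in \<open>auto intro!: H leaf_with1\<close>)
      moreover have "foc_up \<Gamma> (add_mset B \<Delta>)"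
        by (rule IH[of _ k]) (use wfP wf\<Gamma> wf\<Delta> With in \<open>auto intro!: H leaf_with2\<close>)
      ultimately show ?thesis using With by (simp add: with_up)
    next
      case Bot
      then show ?thesis using H0[of "{#}"] by (simp add: leaf_bot bot_up)
    next
      case Top
      then show ?thesis by (simp add: top_up)
    next
      case (All s A)
      have "foc_up (csub (shift [s]) \<Gamma>) (add_mset A (msub (shift [s]) \<Delta>))"
      proof (rule IH[of _ k])
        fix \<theta> \<gamma> assume 1: "is_sbst \<theta>" "leaf k (fsub \<theta> A) \<gamma>"
        have "\<theta> s 0 \<in> Tm s" using 1 by (simp add: is_sbst_def)
        with 1 have "leaf k (fsub (scomp (shift [s]) \<theta>) P) \<gamma>"
          using fsub_eta[of A var \<theta> s] wfP All leaf_all[of "\<theta> s 0" s] by simp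
        from H[OF _ this] show
          "foc_up (csub \<theta> (csub (shift [s]) \<Gamma>) + \<gamma>) (msub \<theta> (msub (shift [s]) \<Delta>))"
          using 1 wf\<Gamma> wf\<Delta> by (simp add: csub_csub msub_msub)
      qed (use wfP wf\<Gamma> wf\<Delta> All in auto)
      then show ?thesis using All by (simp add: all_up)
    next
      case (Neq s t u)
      \<comment> \<open>A unifier makes both sides equal, which is exactly when the inequality has a
        leaf.\<close>
      have "foc_up (csub \<theta> \<Gamma>) (msub \<theta> \<Delta>)" if "unifier t u \<theta>" for \<theta>
        using H[of \<theta> "{#}"] that Neq by (simp add: unifier_def leaf_neq)
      then show ?thesis using Neq neq_up[OF csu_unifiers, of t u] by simp
    next
      case (NAtom a ts)
      then show ?thesis using H0[OF leaf_natom[of k a ts, folded NAtom]] by (simp add: natom_freeze)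
    next
      case (Mu ss B ts)
      show ?thesis
      proof (cases k)
        case 0
        then show ?thesis using Mu H0[of "{#Frozen P#}"] by (simp add: leaf_freeze mu_freeze)
      next
        case (Suc k')
        have "foc_up \<Gamma> (add_mset (unfold_mu ss B ts) \<Delta>)"
          by (rule IH[of _ k'])
            (use wfP wf\<Gamma> wf\<Delta> Mu Suc in \<open>auto intro!: H leaf_unfold simp: fsub_unfold_mu\<close>)
        then show ?thesis using Mu by (simp add: mu_unfold)
      qed
    qed simp_all
  qed
qed

text \<open>Acts as a cut on \<open>A\<close>. If \<open>A\<close> is asynchronous, its leaves
  rebuild a proof of \<open>A\<close> that can be released and handed to \<open>K\<close>; otherwise
  its only leaf is the stored \<open>A\<close>, which \<open>foc_replace\<close> exchanges for
  \<open>K\<close>.\<close>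

lemma leaf_cut:
  assumes "formula A" "wfc \<gamma>" "wfc K" "cont A K"
    and "\<And>\<theta> a. is_sbst \<theta> \<Longrightarrow> leaf k (fsub \<theta> A) a \<Longrightarrow> foc_up (csub \<theta> \<gamma> + a) {#}"
  shows "foc_up (K + \<gamma>) {#}"
proof (cases "async A")
  case True
  have "foc_up \<gamma> {#A#}" by (rule foc_up_leaves[where k = k]) (use assms in auto)
  with True have "foc_dn \<gamma> A" by (rule release)
  with assms show ?thesis by (auto intro: contD)
next
  case False
  then have "foc_up (add_mset (Plain A) \<gamma>) {#}"
    using assms(5)[of var "{#Plain A#}"] assms by (simp add: fsub_var[of "[]"] leaf_sync)
  then show ?thesis by (rule foc_replace(1)) (use assms in auto)
qed

section \<open>Leaves of sequents\<close>

inductive leaves :: "nat \<Rightarrow> ('s, 't, 'a) form multiset \<Rightarrow> ('s, 't, 'a) item multiset \<Rightarrow> bool" for n where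
  leaves_empty: "leaves n {#} {#}"
| leaves_add: "n \<le> k \<Longrightarrow> leaf k P \<gamma> \<Longrightarrow> leaves n \<Gamma> \<gamma>' \<Longrightarrow> leaves n (add_mset P \<Gamma>) (\<gamma> + \<gamma>')"

lemma leaves_emptyD: "leaves n {#} \<gamma> \<Longrightarrow> \<gamma> = {#}"
  by (cases rule: leaves.cases) auto

lemma leaves_addE:
  assumes "leaves n (add_mset P \<Gamma>) \<gamma>"
  obtains k \<gamma>1 \<gamma>2 where "n \<le> k" "leaf k P \<gamma>1" "leaves n \<Gamma> \<gamma>2" "\<gamma> = \<gamma>1 + \<gamma>2"
proof -
  have "leaves n \<Gamma>0 \<gamma> \<Longrightarrow> \<Gamma>0 = add_mset P \<Gamma> \<Longrightarrow>
      \<exists>k \<gamma>1 \<gamma>2. n \<le> k \<and> leaf k P \<gamma>1 \<and> leaves n \<Gamma> \<gamma>2 \<and> \<gamma> = \<gamma>1 + \<gamma>2" for \<Gamma>0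
  proof (induction arbitrary: \<Gamma> rule: leaves.induct)
    case (leaves_add k Q \<gamma> \<Gamma>' \<gamma>')
    show ?case
    proof (cases "Q = P")
      case True
      with leaves_add show ?thesis by auto
    next
      case False
      with leaves_add.prems obtain \<Gamma>'' where
        *: "\<Gamma>' = add_mset P \<Gamma>''" "\<Gamma> = add_mset Q \<Gamma>''" by (auto simp: add_eq_conv_ex)
      from leaves_add.IH[OF *(1)] obtain k' \<gamma>1 \<gamma>2 where
        1: "n \<le> k'" "leaf k' P \<gamma>1" "leaves n \<Gamma>'' \<gamma>2" "\<gamma>' = \<gamma>1 + \<gamma>2" by blast
      from leaves.leaves_add[OF leaves_add.hyps(1,2) 1(3)] have "leaves n \<Gamma> (\<gamma> + \<gamma>2)" using * by simp
      with 1 show ?thesis by (intro exI[of _ k'] exI[of _ \<gamma>1] exI[of _ "\<gamma> + \<gamma>2"]) (simp add: ac_simps)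
    qed
  qed simp
  with assms that show ?thesis by blast
qed

lemma leaves_unionE:
  assumes "leaves n (\<Gamma> + \<Delta>) \<gamma>"
  obtains \<gamma>1 \<gamma>2 where "leaves n \<Gamma> \<gamma>1" "leaves n \<Delta> \<gamma>2" "\<gamma> = \<gamma>1 + \<gamma>2"
proof -
  have "\<exists>\<gamma>1 \<gamma>2. leaves n \<Gamma> \<gamma>1 \<and> leaves n \<Delta> \<gamma>2 \<and> \<gamma> = \<gamma>1 + \<gamma>2"
    using assms
  proof (induction \<Gamma> arbitrary: \<gamma>)
    case empty
    then show ?case by (auto intro: leaves_empty)
  next
    case (add P \<Gamma>)
    then have "leaves n (add_mset P (\<Gamma> + \<Delta>)) \<gamma>" by simp
    then obtain k \<gamma>1 \<gamma>2 where 1: "n \<le> k" "leaf k P \<gamma>1" "leaves n (\<Gamma> + \<Delta>) \<gamma>2" "\<gamma> = \<gamma>1 + \<gamma>2"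
      by (rule leaves_addE)
    from add.IH[OF 1(3)] obtain \<gamma>3 \<gamma>4 where "leaves n \<Gamma> \<gamma>3" "leaves n \<Delta> \<gamma>4" "\<gamma>2 = \<gamma>3 + \<gamma>4" by blast
    with 1 show ?case
      by (intro exI[of _ "\<gamma>1 + \<gamma>3"] exI[of _ \<gamma>4]) (auto intro: leaves_add simp: ac_simps)
  qed
  with that show ?thesis by blast
qed

lemma leaves_mono: "leaves n \<Gamma> \<gamma> \<Longrightarrow> m \<le> n \<Longrightarrow> leaves m \<Gamma> \<gamma>"
proof (induction rule: leaves.induct)
  case (leaves_add k P \<gamma> \<Gamma> \<gamma>')
  then show ?case using leaves.leaves_add[of m k] by simp
qed (rule leaves_empty)

lemma leaves_wf: "leaves n \<Gamma> \<gamma> \<Longrightarrow> wfs \<Gamma> \<Longrightarrow> wfc \<gamma>"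
  by (induction rule: leaves.induct) (auto dest: leaf_wf)

lemma leaves_sub: "leaves n \<Gamma> \<gamma> \<Longrightarrow> wfs \<Gamma> \<Longrightarrow> is_sbst \<sigma> \<Longrightarrow> leaves n (msub \<sigma> \<Gamma>) (csub \<sigma> \<gamma>)"
proof (induction rule: leaves.induct)
  case (leaves_add k P \<gamma> \<Gamma> \<gamma>')
  then show ?case using leaves.leaves_add[of n k "fsub \<sigma> P" "csub \<sigma> \<gamma>"] by (simp add: leaf_sub)
qed (simp add: leaves_empty)

lemma foc_up_leaves_mset:
  "wfs \<Gamma> \<Longrightarrow> wfc \<Xi> \<Longrightarrow> wfs \<Delta> \<Longrightarrow>
    (\<And>\<theta> \<gamma>. is_sbst \<theta> \<Longrightarrow> leaves n (msub \<theta> \<Gamma>) \<gamma> \<Longrightarrow> foc_up (csub \<theta> \<Xi> + \<gamma>) (msub \<theta> \<Delta>)) \<Longrightarrow>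
    foc_up \<Xi> (\<Gamma> + \<Delta>)"
proof (induction \<Gamma> arbitrary: \<Delta>)
  case empty
  then show ?case using empty(4)[of var "{#}"] by (simp add: leaves_empty)
next
  case (add P \<Gamma>)
  have "foc_up \<Xi> (\<Gamma> + add_mset P \<Delta>)"
  proof (rule add.IH)
    fix \<theta> \<gamma> assume 1: "is_sbst \<theta>" "leaves n (msub \<theta> \<Gamma>) \<gamma>"
    have "foc_up (csub \<theta> \<Xi> + \<gamma>) (add_mset (fsub \<theta> P) (msub \<theta> \<Delta>))"
    proof (rule foc_up_leaves[where k = n])
      fix \<theta>' a assume 2: "is_sbst \<theta>'" "leaf n (fsub \<theta>' (fsub \<theta> P)) a"
      have "leaves n (msub (scomp \<theta> \<theta>') (add_mset P \<Gamma>)) (a + csub \<theta>' \<gamma>)"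
        using 1 2 leaves_sub[OF 1(2), of \<theta>'] add.prems leaves_add[of n n _ a]
        by (simp add: msub_msub fsub_fsub[of "[]"])
      from add.prems(4)[OF _ this] show "foc_up (csub \<theta>' (csub \<theta> \<Xi> + \<gamma>) + a) (msub \<theta>' (msub \<theta> \<Delta>))"
        using 1 2 add.prems by (simp add: csub_csub msub_msub ac_simps)
    qed (use 1 leaves_wf[OF 1(2)] add.prems in auto)
    then show "foc_up (csub \<theta> \<Xi> + \<gamma>) (msub \<theta> (add_mset P \<Delta>))" by simp
  qed (use add.prems in auto)
  then show ?case by simp
qed

section \<open>Focusing of cut-free derivations of bounded height\<close>

text \<open>The form in which an induction hypothesis is used below a synchronous rule: the side
  formulas are already decomposed into \<gamma>, and the leaves of the active formula are absorbed
  by \<open>leaf_cut\<close>.\<close>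

lemma leaves_cut:
  assumes "\<And>\<sigma> \<gamma>. is_sbst \<sigma> \<Longrightarrow> leaves m (msub \<sigma> (add_mset P \<Gamma>)) \<gamma> \<Longrightarrow> foc_up \<gamma> {#}"
    and "formula P" "wfs \<Gamma>" "is_sbst \<sigma>" "leaves m (msub \<sigma> \<Gamma>) \<gamma>" "wfc K" "cont (fsub \<sigma> P) K"
  shows "foc_up (K + \<gamma>) {#}"
proof (rule leaf_cut)
  fix \<theta> a assume 1: "is_sbst \<theta>" "leaf m (fsub \<theta> (fsub \<sigma> P)) a"
  have "leaves m (msub (scomp \<sigma> \<theta>) (add_mset P \<Gamma>)) (a + csub \<theta> \<gamma>)"
    using 1 leaves_sub[OF assms(5), of \<theta>] assms leaves_add[of m m _ a]
    by (simp add: msub_msub fsub_fsub[of "[]"])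
  from assms(1)[OF _ this] show "foc_up (csub \<theta> \<gamma> + a) {#}"
    using 1 assms by (simp add: ac_simps)
qed (use assms leaves_wf[OF assms(5)] in auto)

lemma cont_focus:
  assumes "\<not> async P" "formula P"
    and "\<And>\<theta> \<Xi>. is_sbst \<theta> \<Longrightarrow> wfc \<Xi> \<Longrightarrow> foc_dn \<Xi> (fsub \<theta> A) \<Longrightarrow> foc_dn \<Xi> (fsub \<theta> P)"
  shows "cont A {#Plain P#}"
  using assms by (auto simp: cont_def intro: focus)

lemma eSuc_le_enat: "eSuc x \<le> enat n \<longleftrightarrow> (\<exists>m. n = Suc m \<and> x \<le> enat m)"
  by (cases n) (auto simp: zero_enat_def[symmetric] eSuc_enat[symmetric])

lemma foc_of_derives:
  "derives d \<Gamma> \<Longrightarrow> cut_free d \<Longrightarrow> height d \<le> enat n \<Longrightarrow> wfs \<Gamma> \<Longrightarrow> is_sbst \<sigma> \<Longrightarrow>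
    leaves n (msub \<sigma> \<Gamma>) \<gamma> \<Longrightarrow> foc_up \<gamma> {#}"
proof (induction arbitrary: n \<sigma> \<gamma> rule: derives.induct)
  case (init P)
  then have "leaves n (add_mset (fsub \<sigma> P) {#neg (fsub \<sigma> P)#}) \<gamma>" by (simp add: neg_fsub)
  then obtain k \<gamma>1 k' \<gamma>2 where *: "leaf k (fsub \<sigma> P) \<gamma>1" "leaf k' (neg (fsub \<sigma> P)) \<gamma>2" "\<gamma> = \<gamma>1 + \<gamma>2"
    by (elim leaves_addE) (auto dest: leaves_emptyD)
  have wfP: "formula (fsub \<sigma> P)" using init by simp
  \<comment> \<open>Exactly one of the two formulas is asynchronous. The other is its own leaf, and
    focusing on it succeeds by \<open>leaf_dn\<close>, whatever the two fuels are.\<close>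
  show ?case
  proof (cases "async P")
    case True
    then have a: "\<not> async (neg (fsub \<sigma> P))" using wfP by (simp add: async_neg)
    with *(2) have "\<gamma>2 = {#Plain (neg (fsub \<sigma> P))#}" by (rule leaf_syncD)
    with a show ?thesis using focus[OF a leaf_dn[OF *(1) wfP]] * by simp
  next
    case False
    then have a: "\<not> async (fsub \<sigma> P)" by simp
    with *(1) have "\<gamma>1 = {#Plain (fsub \<sigma> P)#}" by (rule leaf_syncD)
    with a show ?thesis using focus[OF a, of \<gamma>2] leaf_dn[OF *(2)] wfP * by simp
  qed
next
  case (cut P d \<Gamma> e \<Delta>)
  then show ?case by simp
next
  case (tensor d P \<Gamma> e Q \<Delta>)
  let ?T = "Tensor P Q"
  obtain m where m: "n = Suc m" "height d \<le> enat m" "height e \<le> enat m"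
    using tensor.prems by (auto simp: eSuc_le_enat)
  have wfs': "formula P" "formula Q" "wfs \<Gamma>" "wfs \<Delta>" using tensor.prems by auto
  from tensor.prems have "leaves n (add_mset (fsub \<sigma> ?T) (msub \<sigma> \<Gamma> + msub \<sigma> \<Delta>)) \<gamma>" by simp
  then obtain k \<gamma>1 \<gamma>2 \<gamma>3 where *: "leaf k (fsub \<sigma> ?T) \<gamma>1" "leaves n (msub \<sigma> \<Gamma>) \<gamma>2"
      "leaves n (msub \<sigma> \<Delta>) \<gamma>3" "\<gamma> = \<gamma>1 + (\<gamma>2 + \<gamma>3)"
    by (elim leaves_addE leaves_unionE) auto
  have \<gamma>1: "\<gamma>1 = {#Plain (fsub \<sigma> ?T)#}" using leaf_syncD[OF *(1)] by simp
  have \<gamma>2: "leaves m (msub \<sigma> \<Gamma>) \<gamma>2" and \<gamma>3: "leaves m (msub \<sigma> \<Delta>) \<gamma>3"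
    using * m by (auto elim: leaves_mono)
  have wf\<gamma>3: "wfc \<gamma>3" using leaves_wf[OF \<gamma>3] wfs' tensor.prems by auto
  \<comment> \<open>Two nested cuts: a context focusing on \<open>P\<close> is collected first, then
    one focusing on \<open>Q\<close>; only then is the stored tensor focused on, with both contexts
    at hand.\<close>
  have "foc_up ((\<gamma>1 + \<gamma>3) + \<gamma>2) {#}"
  proof (rule leaves_cut[where m = m and P = P and \<Gamma> = \<Gamma> and \<sigma> = \<sigma>])
    show "cont (fsub \<sigma> P) (\<gamma>1 + \<gamma>3)"
      unfolding cont_def
    proof (intro allI impI)
      fix \<theta> \<Xi> assume 1: "is_sbst \<theta>" "wfc \<Xi>" "foc_dn \<Xi> (fsub \<theta> (fsub \<sigma> P))"
      have "foc_up (add_mset (Plain (fsub (scomp \<sigma> \<theta>) ?T)) \<Xi> + csub \<theta> \<gamma>3) {#}"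
      proof (rule leaves_cut[where m = m and P = Q and \<Gamma> = \<Delta> and \<sigma> = "scomp \<sigma> \<theta>"])
        show "leaves m (msub (scomp \<sigma> \<theta>) \<Delta>) (csub \<theta> \<gamma>3)"
          using leaves_sub[OF \<gamma>3, of \<theta>] 1 wfs' tensor.prems by (simp add: msub_msub)
        show "cont (fsub (scomp \<sigma> \<theta>) Q) (add_mset (Plain (fsub (scomp \<sigma> \<theta>) ?T)) \<Xi>)"
          unfolding cont_def
        proof (intro allI impI)
          fix \<theta>' \<Xi>' assume 2: "is_sbst \<theta>'" "wfc \<Xi>'" "foc_dn \<Xi>' (fsub \<theta>' (fsub (scomp \<sigma> \<theta>) Q))"
          have "foc_dn (csub \<theta>' \<Xi>) (fsub \<theta>' (fsub \<theta> (fsub \<sigma> P)))"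
            using 1 2 wfs' tensor.prems by (intro foc_sub) auto
          then have "foc_dn (csub \<theta>' \<Xi> + \<Xi>') (fsub \<theta>' (fsub (scomp \<sigma> \<theta>) ?T))"
            using 1 2 wfs' tensor.prems by (simp add: fsub_fsub[of "[]"] tensor_dn)
          then show "foc_up (csub \<theta>' (add_mset (Plain (fsub (scomp \<sigma> \<theta>) ?T)) \<Xi>) + \<Xi>') {#}"
            by (simp add: focus)
        qed
      qed (use 1 wfs' tensor.prems tensor.IH(2) m in auto)
      then show "foc_up (csub \<theta> (\<gamma>1 + \<gamma>3) + \<Xi>) {#}"
        using 1 wfs' tensor.prems by (simp add: \<gamma>1 fsub_fsub[of "[]"] ac_simps)
    qed
  qed (use wfs' wf\<gamma>3 tensor.prems \<gamma>1 \<gamma>2 tensor.IH(1) m in auto)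
  then show ?case using * by (simp add: ac_simps)
next
  case (par d P Q \<Gamma>)
  obtain m where m: "n = Suc m" "height d \<le> enat m"
    using par.prems by (auto simp: eSuc_le_enat)
  from par.prems have "leaves n (add_mset (fsub \<sigma> (Par P Q)) (msub \<sigma> \<Gamma>)) \<gamma>" by simp
  then obtain k \<gamma>1 \<gamma>2 where 1: "n \<le> k" "leaf k (fsub \<sigma> (Par P Q)) \<gamma>1"
      "leaves n (msub \<sigma> \<Gamma>) \<gamma>2" "\<gamma> = \<gamma>1 + \<gamma>2"
    by (rule leaves_addE)
  from 1(2) obtain \<gamma>3 \<gamma>4 where "leaf k (fsub \<sigma> P) \<gamma>3" "leaf k (fsub \<sigma> Q) \<gamma>4" "\<gamma>1 = \<gamma>3 + \<gamma>4"
    by (auto elim!: leaf_elims)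
  with 1 leaves_mono[OF 1(3), of m] m have *: "n \<le> k" "leaf k (fsub \<sigma> P) \<gamma>3" "leaf k (fsub \<sigma> Q) \<gamma>4"
      "leaves m (msub \<sigma> \<Gamma>) \<gamma>2" "\<gamma> = \<gamma>3 + \<gamma>4 + \<gamma>2"
    by auto
  have "leaves m (msub \<sigma> (add_mset P (add_mset Q \<Gamma>))) (\<gamma>3 + (\<gamma>4 + \<gamma>2))"
    using * m by (simp add: leaves_add[of m k])
  then have "foc_up (\<gamma>3 + (\<gamma>4 + \<gamma>2)) {#}"
    using par.prems m by (intro par.IH[of m \<sigma>]) auto
  then show ?case using * by (simp add: ac_simps)
next
  case (plus1 d P \<Gamma> Q)
  obtain m where m: "n = Suc m" "height d \<le> enat m"
    using plus1.prems by (auto simp: eSuc_le_enat)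
  from plus1.prems have "leaves n (add_mset (fsub \<sigma> (Plus P Q)) (msub \<sigma> \<Gamma>)) \<gamma>" by simp
  then obtain k \<gamma>1 \<gamma>2 where *: "leaf k (fsub \<sigma> (Plus P Q)) \<gamma>1" "leaves n (msub \<sigma> \<Gamma>) \<gamma>2" "\<gamma> = \<gamma>1 + \<gamma>2"
    by (rule leaves_addE)
  have \<gamma>1: "\<gamma>1 = {#Plain (fsub \<sigma> (Plus P Q))#}" using leaf_syncD[OF *(1)] by simp
  have "foc_up (\<gamma>1 + \<gamma>2) {#}"
    unfolding \<gamma>1
  proof (rule leaves_cut[where m = m and P = P and \<Gamma> = \<Gamma> and \<sigma> = \<sigma>])
    show "cont (fsub \<sigma> P) {#Plain (fsub \<sigma> (Plus P Q))#}"
      using plus1.prems by (intro cont_focus) (auto intro: plus1_dn)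
    show "leaves m (msub \<sigma> \<Gamma>) \<gamma>2" using * m by (auto elim: leaves_mono)
  qed (use plus1.prems plus1.IH m in auto)
  then show ?case using * by simp
next
  case (plus2 d Q \<Gamma> P)
  obtain m where m: "n = Suc m" "height d \<le> enat m"
    using plus2.prems by (auto simp: eSuc_le_enat)
  from plus2.prems have "leaves n (add_mset (fsub \<sigma> (Plus P Q)) (msub \<sigma> \<Gamma>)) \<gamma>" by simp
  then obtain k \<gamma>1 \<gamma>2 where *: "leaf k (fsub \<sigma> (Plus P Q)) \<gamma>1" "leaves n (msub \<sigma> \<Gamma>) \<gamma>2" "\<gamma> = \<gamma>1 + \<gamma>2"
    by (rule leaves_addE)
  have \<gamma>1: "\<gamma>1 = {#Plain (fsub \<sigma> (Plus P Q))#}" using leaf_syncD[OF *(1)] by simp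
  have "foc_up (\<gamma>1 + \<gamma>2) {#}"
    unfolding \<gamma>1
  proof (rule leaves_cut[where m = m and P = Q and \<Gamma> = \<Gamma> and \<sigma> = \<sigma>])
    show "cont (fsub \<sigma> Q) {#Plain (fsub \<sigma> (Plus P Q))#}"
      using plus2.prems by (intro cont_focus) (auto intro: plus2_dn)
    show "leaves m (msub \<sigma> \<Gamma>) \<gamma>2" using * m by (auto elim: leaves_mono)
  qed (use plus2.prems plus2.IH m in auto)
  then show ?case using * by simp
next
  case (withr d P \<Gamma> e Q)
  obtain m where m: "n = Suc m" "height d \<le> enat m" "height e \<le> enat m"
    using withr.prems by (auto simp: eSuc_le_enat)
  from withr.prems have "leaves n (add_mset (fsub \<sigma> (With P Q)) (msub \<sigma> \<Gamma>)) \<gamma>" by simp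
  then obtain k \<gamma>1 \<gamma>2 where *: "n \<le> k" "leaf k (fsub \<sigma> (With P Q)) \<gamma>1" "leaves n (msub \<sigma> \<Gamma>) \<gamma>2" "\<gamma> = \<gamma>1 + \<gamma>2"
    by (rule leaves_addE)
  then have "leaves m (msub \<sigma> (add_mset P \<Gamma>)) \<gamma> \<or> leaves m (msub \<sigma> (add_mset Q \<Gamma>)) \<gamma>"
    using m leaves_mono[OF *(3), of m] by (auto elim!: leaf_elims simp: leaves_add[of m k])
  then show ?case
  proof
    assume "leaves m (msub \<sigma> (add_mset P \<Gamma>)) \<gamma>"
    then show ?thesis using withr.prems m by (intro withr.IH(1)[of m \<sigma>]) auto
  next
    assume "leaves m (msub \<sigma> (add_mset Q \<Gamma>)) \<gamma>"
    then show ?thesis using withr.prems m by (intro withr.IH(2)[of m \<sigma>]) auto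
  qed
next
  case one
  then have "\<gamma> = {#Plain One#}"
    by (auto elim!: leaves_addE dest!: leaves_emptyD leaf_syncD)
  then show ?case by (simp add: focus one_dn)
next
  case (bot d \<Gamma>)
  obtain m where m: "n = Suc m" "height d \<le> enat m"
    using bot.prems by (auto simp: eSuc_le_enat)
  from bot.prems have "leaves n (msub \<sigma> \<Gamma>) \<gamma>"
    by (auto elim!: leaves_addE leaf_elims)
  then have "leaves m (msub \<sigma> \<Gamma>) \<gamma>" using m by (auto elim: leaves_mono)
  then show ?case using bot.prems m by (intro bot.IH[of m \<sigma>]) auto
next
  case (top \<Gamma>)
  then show ?case by (auto elim!: leaves_addE leaf_elims)
next
  case (ex t s d P \<Gamma>)
  obtain m where m: "n = Suc m" "height d \<le> enat m"
    using ex.prems by (auto simp: eSuc_le_enat)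
  have wfs': "formula P" "wfs \<Gamma>" using ex.prems by auto
  from ex.prems have "leaves n (add_mset (fsub \<sigma> (Ex s P)) (msub \<sigma> \<Gamma>)) \<gamma>" by simp
  then obtain k \<gamma>1 \<gamma>2 where *: "leaf k (fsub \<sigma> (Ex s P)) \<gamma>1" "leaves n (msub \<sigma> \<Gamma>) \<gamma>2" "\<gamma> = \<gamma>1 + \<gamma>2"
    by (rule leaves_addE)
  have \<gamma>1: "\<gamma>1 = {#Plain (fsub \<sigma> (Ex s P))#}" using leaf_syncD[OF *(1)] by simp
  have "foc_up (\<gamma>1 + \<gamma>2) {#}"
    unfolding \<gamma>1
  proof (rule leaves_cut[where m = m and P = "fsub (inst [s] [t]) P" and \<Gamma> = \<Gamma> and \<sigma> = \<sigma>])
    show "cont (fsub \<sigma> (fsub (inst [s] [t]) P)) {#Plain (fsub \<sigma> (Ex s P))#}"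
    proof (rule cont_focus)
      fix \<theta> \<Xi> assume 1: "is_sbst \<theta>" "foc_dn \<Xi> (fsub \<theta> (fsub \<sigma> (fsub (inst [s] [t]) P)))"
      then have "foc_dn \<Xi> (fsub (inst [s] [tsub (scomp \<sigma> \<theta>) t]) (fsub (ups [s] (scomp \<sigma> \<theta>)) P))"
        using fsub_inst[of "[]" P "[t]" "[s]" "scomp \<sigma> \<theta>"]
          fsub_fsub[of "[]" "fsub (inst [s] [t]) P" \<sigma> \<theta>] ex wfs' by simp
      then have "foc_dn \<Xi> (fsub (scomp \<sigma> \<theta>) (Ex s P))"
        using ex_dn[of "tsub (scomp \<sigma> \<theta>) t" s \<Xi>] ex.hyps ex.prems 1 by (simp add: is_sbst_Tm)
      then show "foc_dn \<Xi> (fsub \<theta> (fsub \<sigma> (Ex s P)))"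
        using fsub_fsub[of "[]" "Ex s P" \<sigma> \<theta>] 1 wfs' ex.prems by simp
    qed (use ex.prems in auto)
    show "leaves m (msub \<sigma> \<Gamma>) \<gamma>2" using * m by (auto elim: leaves_mono)
  qed (use ex.hyps ex.prems ex.IH m in auto)
  then show ?case using * by simp
next
  case (all d P s \<Gamma>)
  obtain m where m: "n = Suc m" "height d \<le> enat m"
    using all.prems by (auto simp: eSuc_le_enat)
  have wfs': "formula P" "wfs \<Gamma>" using all.prems by auto
  from all.prems have "leaves n (add_mset (fsub \<sigma> (All s P)) (msub \<sigma> \<Gamma>)) \<gamma>" by simp
  then obtain k \<gamma>1 \<gamma>2 where 1: "n \<le> k" "leaf k (fsub \<sigma> (All s P)) \<gamma>1"
      "leaves n (msub \<sigma> \<Gamma>) \<gamma>2" "\<gamma> = \<gamma>1 + \<gamma>2"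
    by (rule leaves_addE)
  from 1(2) obtain t where "t \<in> Tm s" "leaf k (fsub (inst [s] [t]) (fsub (ups [s] \<sigma>) P)) \<gamma>1"
    by (auto elim!: leaf_elims)
  with 1 leaves_mono[OF 1(3), of m] m have *: "n \<le> k" "t \<in> Tm s"
      "leaf k (fsub (inst [s] [t]) (fsub (ups [s] \<sigma>) P)) \<gamma>1" "leaves m (msub \<sigma> \<Gamma>) \<gamma>2" "\<gamma> = \<gamma>1 + \<gamma>2"
    by auto
  \<comment> \<open>The leaf chose \<open>t\<close> for the quantified variable, so the premise is
    used at the substitution sending the eigenvariable to \<open>t\<close> and acting as \<sigma> on
    the shifted variables.\<close>
  define \<tau> where "\<tau> = sconss [s] [t] \<sigma>"
  have \<tau>: "is_sbst \<tau>" using * all.prems by (simp add: \<tau>_def)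
  have "scomp (shift [s]) \<tau> = \<sigma>"
    unfolding \<tau>_def using * all.prems by (intro shift_sconss) auto
  then have "msub \<tau> (msub (shift [s]) \<Gamma>) = msub \<sigma> \<Gamma>" using \<tau> wfs' by (simp add: msub_msub)
  moreover have "fsub (inst [s] [t]) (fsub (ups [s] \<sigma>) P) = fsub \<tau> P"
    unfolding \<tau>_def using ups_inst[of "[t]" "[s]" \<sigma>] fsub_fsub[of "[]" P "ups [s] \<sigma>" "inst [s] [t]"]
      * wfs' all.prems by simp
  ultimately have "leaves m (msub \<tau> (add_mset P (msub (shift [s]) \<Gamma>))) \<gamma>"
    using * m by (simp add: leaves_add[of m k])
  then show ?case using all.prems m \<tau> wfs' by (intro all.IH[of m \<tau>]) auto
next
  case (eq s t)
  then have "\<gamma> = {#Plain (Eq s (tsub \<sigma> t) (tsub \<sigma> t))#}"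
    by (auto elim!: leaves_addE dest!: leaves_emptyD leaf_syncD)
  then show ?case by (simp add: focus eq_dn)
next
  case (neq t u U f \<Gamma> s)
  obtain m where m: "n = Suc m" "(SUP \<theta>\<in>U. height (f \<theta>)) \<le> enat m"
    using neq.prems by (auto simp: eSuc_le_enat)
  from neq.prems have "leaves n (add_mset (fsub \<sigma> (Neq s t u)) (msub \<sigma> \<Gamma>)) \<gamma>" by simp
  \<comment> \<open>The instantiated inequality has a leaf only if \<sigma> already unifies its
    sides; \<sigma> then factors through some unifier of the rule.\<close>
  then have *: "tsub \<sigma> t = tsub \<sigma> u" "leaves n (msub \<sigma> \<Gamma>) \<gamma>"
    by (auto elim!: leaves_addE leaf_elims)
  then have "unifier t u \<sigma>" using neq.prems by (simp add: unifier_def)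
  then obtain \<theta> \<delta> where 1: "\<theta> \<in> U" "is_sbst \<theta>" "is_sbst \<delta>" "\<sigma> = scomp \<theta> \<delta>"
    using csu_factor[OF neq.hyps(1)] by metis
  have "height (f \<theta>) \<le> enat m" using m 1 by (auto simp: SUP_le_iff)
  moreover have "leaves m (msub \<delta> (msub \<theta> \<Gamma>)) \<gamma>"
    using leaves_mono[OF *(2), of m] m 1 neq.prems by (simp add: msub_msub)
  ultimately show ?case using neq.prems 1 by (intro neq.IH[of \<theta> m \<delta>]) auto
next
  case (mu d ss B ts \<Gamma>)
  obtain m where m: "n = Suc m" "height d \<le> enat m"
    using mu.prems by (auto simp: eSuc_le_enat)
  have wfs': "wf [ss] B" "well_sorted ts ss" "wfs \<Gamma>" using mu.prems by auto
  from mu.prems have "leaves n (add_mset (fsub \<sigma> (Mu ss B ts)) (msub \<sigma> \<Gamma>)) \<gamma>" by simp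
  then obtain k \<gamma>1 \<gamma>2 where *: "n \<le> k" "leaf k (fsub \<sigma> (Mu ss B ts)) \<gamma>1" "leaves n (msub \<sigma> \<Gamma>) \<gamma>2" "\<gamma> = \<gamma>1 + \<gamma>2"
    by (rule leaves_addE)
  \<comment> \<open>The fuel is at least \<open>Suc m\<close>, so the leaf cannot have frozen this
    formula and must have unfolded it.\<close>
  then obtain k' where k': "k = Suc k'" "m \<le> k'" using m by (cases k) auto
  with * have "leaf k' (fsub \<sigma> (unfold_mu ss B ts)) \<gamma>1"
    using wfs' mu.prems by (auto elim!: leaf_elims simp: fsub_unfold_mu)
  then have "leaves m (msub \<sigma> (add_mset (unfold_mu ss B ts) \<Gamma>)) \<gamma>"
    using * k' m leaves_mono[OF *(3), of m] by (simp add: leaves_add[of m k'])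
  then show ?case using mu.prems m wfs' by (intro mu.IH[of m \<sigma>]) auto
next
  case (nu S d ss ts \<Gamma> e B)
  obtain m where m: "n = Suc m" "height d \<le> enat m" "height e \<le> enat m"
    using nu.prems by (auto simp: eSuc_le_enat)
  have wfs': "wf [ss] B" "well_sorted ts ss" "wfs \<Gamma>" "formula S" using nu.prems nu.hyps by auto
  from nu.prems have "leaves n (add_mset (fsub \<sigma> (Nu ss B ts)) (msub \<sigma> \<Gamma>)) \<gamma>" by simp
  then obtain k \<gamma>1 \<gamma>2 where *: "leaf k (fsub \<sigma> (Nu ss B ts)) \<gamma>1" "leaves n (msub \<sigma> \<Gamma>) \<gamma>2" "\<gamma> = \<gamma>1 + \<gamma>2"
    by (rule leaves_addE)
  have \<gamma>1: "\<gamma>1 = {#Plain (fsub \<sigma> (Nu ss B ts))#}" using leaf_syncD[OF *(1)] by simp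
  \<comment> \<open>\<open>nu_coind\<close> needs the invariance premise as a full asynchronous
    sequent, so it is reassembled from its leaves, which are provable by induction.\<close>
  have "foc_up {#} ({#papp ss B S, neg S#} + {#})"
  proof (rule foc_up_leaves_mset[where n = m])
    fix \<theta> \<gamma> assume "is_sbst \<theta>" "leaves m (msub \<theta> {#papp ss B S, neg S#}) \<gamma>"
    then show "foc_up (csub \<theta> {#} + \<gamma>) (msub \<theta> {#})"
      using nu.IH(2)[of m \<theta> \<gamma>] nu.prems m wfs' by auto
  qed (use wfs' in auto)
  then have coind: "foc_up {#} {#papp ss B S, neg S#}" by simp
  have "foc_up (\<gamma>1 + \<gamma>2) {#}"
    unfolding \<gamma>1
  proof (rule leaves_cut[where m = m and P = "fsub (inst ss ts) S" and \<Gamma> = \<Gamma> and \<sigma> = \<sigma>])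
    show "cont (fsub \<sigma> (fsub (inst ss ts) S)) {#Plain (fsub \<sigma> (Nu ss B ts))#}"
    proof (rule cont_focus)
      fix \<theta> \<Xi> assume 1: "is_sbst \<theta>" "foc_dn \<Xi> (fsub \<theta> (fsub \<sigma> (fsub (inst ss ts) S)))"
      let ?\<tau> = "scomp \<sigma> \<theta>"
      have \<tau>: "is_sbst ?\<tau>" using 1 nu.prems by simp
      have "foc_dn \<Xi> (fsub (inst ss (map (tsub ?\<tau>) ts)) (plift ss ?\<tau> S))"
        using 1 fsub_inst[of "[]" S ts ss ?\<tau>]
          fsub_fsub[of "[]" "fsub (inst ss ts) S" \<sigma> \<theta>] wfs' nu.prems by (simp add: plift_def)
      moreover have "foc_up {#} {#papp ss (plift ss ?\<tau> B) (plift ss ?\<tau> S), neg (plift ss ?\<tau> S)#}"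
        using foc_sub(1)[OF coind, of "ups ss ?\<tau>"] \<tau> wfs' plift_papp[of ss B S ?\<tau>]
        by (simp add: plift_def neg_fsub)
      ultimately have "foc_dn \<Xi> (Nu ss (plift ss ?\<tau> B) (map (tsub ?\<tau>) ts))"
        using \<tau> wfs' by (intro nu_coind[where S = "plift ss ?\<tau> S"]) auto
      then have "foc_dn \<Xi> (fsub ?\<tau> (Nu ss B ts))" by (simp add: plift_def)
      then show "foc_dn \<Xi> (fsub \<theta> (fsub \<sigma> (Nu ss B ts)))"
        using fsub_fsub[of "[]" "Nu ss B ts" \<sigma> \<theta>] 1 wfs' nu.prems by (simp del: fsub.simps)
    qed (use wfs' nu.prems in auto)
    show "leaves m (msub \<sigma> \<Gamma>) \<gamma>2" using * m by (auto elim: leaves_mono)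
  qed (use wfs' nu.prems nu.IH(1) m in auto)
  then show ?case using * by simp
qed

lemma foc_up_of_quasi_finite:
  assumes "derives d \<Gamma>" "quasi_finite d" "wfs \<Gamma>"
  shows "foc_up {#} \<Gamma>"
proof -
  obtain n where "cut_free d" "height d \<le> enat n"
    using assms(2) by (cases "height d") (auto simp: quasi_finite_def)
  then have "foc_up {#} (\<Gamma> + {#})"
    using assms foc_of_derives[OF assms(1)] by (intro foc_up_leaves_mset[where n = n]) auto
  then show ?thesis by simp
qed

section \<open>Soundness\<close>

primrec unfreeze :: "('s, 't, 'a) item \<Rightarrow> ('s, 't, 'a) form" where
  "unfreeze (Plain P) = P"
| "unfreeze (Frozen P) = P"

lemma unfreeze_isub: "image_mset unfreeze (csub \<sigma> \<Gamma>) = msub \<sigma> (image_mset unfreeze \<Gamma>)"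
proof (induction \<Gamma>)
  case (add i \<Gamma>)
  then show ?case by (cases i) simp_all
qed simp

text \<open>After erasing the marks, storing, freezing, focusing and releasing do not change the
  sequent, the two axioms on frozen formulas are instances of \<open>init\<close>, and the remaining
  rules are rules of \<mu>MALL.\<close>

lemma provable_of_foc:
  "foc_up \<Gamma> \<Delta> \<Longrightarrow> provable (image_mset unfreeze \<Gamma> + \<Delta>)"
  "foc_dn \<Gamma> P \<Longrightarrow> provable (add_mset P (image_mset unfreeze \<Gamma>))"
proof (induction rule: foc_up_foc_dn.inducts)
  case (neq_up t u U \<Gamma> \<Delta> s)
  then have "\<forall>\<theta>\<in>U. \<exists>d. derives d (msub \<theta> (image_mset unfreeze \<Gamma> + \<Delta>))"
    by (simp add: provable_def unfreeze_isub)
  then obtain f where "\<And>\<theta>. \<theta> \<in> U \<Longrightarrow> derives (f \<theta>) (msub \<theta> (image_mset unfreeze \<Gamma> + \<Delta>))"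
    by metis
  from neq[OF neq_up(1) this, of s] show ?case by (auto simp: provable_def)
next
  case (all_up s \<Gamma> P \<Delta>)
  then obtain d where "derives d (add_mset P (msub (shift [s]) (image_mset unfreeze \<Gamma> + \<Delta>)))"
    by (auto simp: provable_def unfreeze_isub)
  from all[OF this] show ?case by (auto simp: provable_def)
next
  case (tensor_dn \<Gamma> P \<Gamma>' Q)
  then show ?case by (auto simp: provable_def intro: tensor)
next
  case (nu_coind S \<Gamma> ss ts B)
  then show ?case by (auto simp: provable_def dest: nu)
next
  case (atom_dn a ts)
  show ?case using init[of "Atom a ts"] by (auto simp: provable_def)
next
  case (nu_ax ss B ts)
  show ?case using init[of "Nu ss B ts"] by (auto simp: provable_def)
qed (auto simp: provable_def unfreeze_isub add_mset_commute intro: derives.intros)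

end

theorem mainTheorem6:
  fixes Tm :: "'s \<Rightarrow> 't set"
    and var :: "'s \<Rightarrow> nat \<Rightarrow> 't"
    and tsub :: "('s, 't) sbst \<Rightarrow> 't \<Rightarrow> 't"
    and ar :: "'a \<Rightarrow> 's list"
    and \<Gamma> :: "('s, 't, 'a) form multiset"
  assumes "term_language Tm var tsub"
    and "\<forall>P\<in>#\<Gamma>. mumall.formula Tm ar P"
  shows "(mumall.foc_up Tm var tsub ar {#} \<Gamma> \<longrightarrow> mumall.provable Tm var tsub ar \<Gamma>) \<and>
         ((\<exists>d. mumall.derives Tm var tsub ar d \<Gamma> \<and> quasi_finite d) \<longrightarrow>
            mumall.foc_up Tm var tsub ar {#} \<Gamma>)"
proof -
  interpret mumall Tm var tsub ar
    using assms(1) by (simp add: mumall_def)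
  show ?thesis
    using assms(2) provable_of_foc(1)[of "{#}" \<Gamma>] foc_up_of_quasi_finite by auto
qed

end
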